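(* Let $m \ge 3$ be odd and $n = 3^m-1$. Then the dual code $\mathcal{C}_{(0,3,m)}^\perp$ has parameters $[n,k,d]$ with $d \ge \frac{3^{(m-1)/2}+15}{2}$ if $m \equiv 1 \pmod 4$ and $d \ge \frac{3^{(m-1)/2}+13}{2}$ if $m \equiv 3 \pmod 4$, and $k = \frac{n-2}{2}$ if $m \equiv 1 \pmod 4$ and $k = \frac{n}{2}$ if $m \equiv 3 \pmod 4$.
   Context: Let $m \ge 2$ be an integer, $n = 3^m-1$, and let $\alpha$ be a primitive element of $\mathbb{F}_{3^m}$. For an integer $0 \le j \le n-1$ with $3$-adic expansion $j = \sum_{t=0}^{m-1} j_t 3^t$, $j_t \in \{0,1,2\}$, let $w_3(j) = \sum_{t=0}^{m-1} j_t$. For distinct $i_1, i_2 \in \{0,1,2,3\}$ let $T_{(i_1,i_2,m)} = \{1 \le j \le n-1 : w_3(j) \equiv i_1 \text{ or } i_2 \pmod 4\}$ and $g_{(i_1,i_2,m)}(x) = \prod_{j \in T_{(i_1,i_2,m)}} (x - \alpha^j) \in \mathbb{F}_3[x]$. $\mathcal{C}_{(i_1,i_2,m)}$ denotes the ternary cyclic code of length $n$ with generator polynomial $g_{(i_1,i_2,m)}(x)$, and $\mathcal{C}^\perp$ denotes the dual code with respect to the standard inner product on $\mathbb{F}_3^n$. Parameters $[n,k,d]$ mean length, dimension over $\mathbb{F}_3$, and minimum Hamming distance. *)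

theory Defs
  imports "HOL-Computational_Algebra.Polynomial"
begin

fun w3 :: "nat \<Rightarrow> nat" where
  "w3 j = (if j = 0 then 0 else j mod 3 + w3 (j div 3))"

definition primitive_elem :: "'a::{field,finite} \<Rightarrow> bool" where
  "primitive_elem \<alpha> \<longleftrightarrow> \<alpha> \<noteq> 0 \<and> (\<forall>x::'a. x \<noteq> 0 \<longrightarrow> (\<exists>j::nat. x = \<alpha> ^ j))"

definition T_set :: "nat \<Rightarrow> nat \<Rightarrow> nat \<Rightarrow> nat set" where
  "T_set i1 i2 m = {j. 1 \<le> j \<and> j \<le> 3 ^ m - 2 \<and> (w3 j mod 4 = i1 \<or> w3 j mod 4 = i2)}"

definition gen_poly :: "'a::{field,finite} \<Rightarrow> nat \<Rightarrow> nat \<Rightarrow> nat \<Rightarrow> 'a poly" where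
  "gen_poly \<alpha> i1 i2 m = (\<Prod>j\<in>T_set i1 i2 m. [:- (\<alpha> ^ j), 1:])"

text \<open>Words of length n over the prime subfield (F_3, since char = 3),
  represented as functions vanishing outside {..<n}.\<close>
definition words :: "nat \<Rightarrow> (nat \<Rightarrow> 'a::{field,finite}) set" where
  "words n = {c. (\<forall>i. c i \<in> range of_int) \<and> (\<forall>i\<ge>n. c i = 0)}"

definition poly_of_word :: "nat \<Rightarrow> (nat \<Rightarrow> 'a::{field,finite}) \<Rightarrow> 'a poly" where
  "poly_of_word n c = (\<Sum>i<n. monom (c i) i)"

definition cyclic_code :: "'a::{field,finite} \<Rightarrow> nat \<Rightarrow> nat \<Rightarrow> nat \<Rightarrow> (nat \<Rightarrow> 'a) set" where
  "cyclic_code \<alpha> i1 i2 m =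
     {c \<in> words (3 ^ m - 1). gen_poly \<alpha> i1 i2 m dvd poly_of_word (3 ^ m - 1) c}"

definition dual_code :: "nat \<Rightarrow> (nat \<Rightarrow> 'a::{field,finite}) set \<Rightarrow> (nat \<Rightarrow> 'a) set" where
  "dual_code n C = {v \<in> words n. \<forall>c\<in>C. (\<Sum>i<n. v i * c i) = 0}"

definition hweight :: "nat \<Rightarrow> (nat \<Rightarrow> 'a::zero) \<Rightarrow> nat" where
  "hweight n c = card {i. i < n \<and> c i \<noteq> 0}"

definition min_dist :: "nat \<Rightarrow> (nat \<Rightarrow> 'a::zero) set \<Rightarrow> nat" where
  "min_dist n C = Min {hweight n c | c. c \<in> C \<and> c \<noteq> (\<lambda>_. 0)}"

definition code_dim :: "(nat \<Rightarrow> 'a) set \<Rightarrow> nat" where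
  "code_dim C = (THE k. card C = 3 ^ k)"

end

theory Submission
  imports Defs "HOL-Library.FuncSet" "HOL-Computational_Algebra.Primes"
begin

text \<open>
  Orthogonality to the trace words of the code shows that the dual code consists of the words over
  the prime field that vanish at the powers of the primitive element with exponent j < n and
  w3 j mod 4 < 2.  Its dimension is then the number of the remaining exponents.

  For the distance write m = 2h + 1 and q = 3 ^ h.  The multiples i (q - 1) with 1 \<le> i \<le> q have
  digit sum 2h, so they, or their negatives, give about q zeros in arithmetic progression, but
  gcd (q - 1) n = 2.  The BCH argument therefore applies to the word folded modulo n / 2, unless the
  folded word vanishes.  In that case all nonzero entries come in opposite pairs, and a progression
  of odd exponents with the same step bounds the number of pairs.

  For m = 3 this is too weak to exclude weight 7.  There a word with at most 7 nonzero entries has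
  a locator polynomial of degree 7.  The recurrence that it imposes on the values of the word has
  no solution in the field with 27 elements.
\<close>

section \<open>Ternary digit sums\<close>

declare w3.simps [simp del]

lemma w3_0 [simp]: "w3 0 = 0"
  by (simp add: w3.simps)

lemma w3_digit: "r < 3 \<Longrightarrow> w3 (3 * a + r) = w3 a + r"
  by (subst w3.simps) auto

lemma w3_append: "b < 3 ^ k \<Longrightarrow> w3 (a * 3 ^ k + b) = w3 a + w3 b"
proof (induction k arbitrary: b)
  case (Suc k)
  have b: "b = 3 * (b div 3) + b mod 3" by simp
  have "w3 (a * 3 ^ Suc k + b) = w3 (3 * (a * 3 ^ k + b div 3) + b mod 3)"
    by (rule arg_cong[of _ _ w3]) (simp add: algebra_simps)
  also have "\<dots> = w3 a + (w3 (b div 3) + b mod 3)"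
    using Suc by (subst w3_digit) auto
  also have "w3 (b div 3) + b mod 3 = w3 b"
    by (metis b w3_digit mod_less_divisor zero_less_numeral)
  finally show ?case .
qed simp

lemma w3_power [simp]: "w3 (3 ^ k) = 1"
  using w3_append[of 0 k 1] w3_digit[of 1 0] by simp

text \<open>Subtraction from 3^k - 1 replaces every digit d by 2 - d, without borrowing.\<close>

lemma w3_complement: "j < 3 ^ k \<Longrightarrow> w3 (3 ^ k - 1 - j) + w3 j = 2 * k"
proof (induction k arbitrary: j)
  case (Suc k)
  have j: "j = 3 * (j div 3) + j mod 3" by simp
  have lt: "j div 3 < 3 ^ k" using Suc.prems by auto
  have "w3 (3 ^ Suc k - 1 - j) = w3 (3 * (3 ^ k - 1 - j div 3) + (2 - j mod 3))"
    by (rule arg_cong[of _ _ w3]) (use j lt in \<open>simp; linarith\<close>)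
  also have "\<dots> = w3 (3 ^ k - 1 - j div 3) + (2 - j mod 3)"
    by (rule w3_digit) simp
  finally have 1: "w3 (3 ^ Suc k - 1 - j) = w3 (3 ^ k - 1 - j div 3) + (2 - j mod 3)" .
  have 2: "w3 j = w3 (j div 3) + j mod 3"
    by (metis j w3_digit mod_less_divisor zero_less_numeral)
  have "j mod 3 \<le> 2" by simp
  then show ?case using 1 2 Suc.IH[OF lt] by simp
qed simp

text \<open>The product consists of i - 1 followed by a block of h digits that complements i - 1, so
  the two digit sums add up to 2h for every i.\<close>

lemma w3_mult_pred_power:
  assumes "1 \<le> i" "i \<le> 3 ^ h"
  shows "w3 (i * (3 ^ h - 1)) = 2 * h"
proof -
  have "i * (3 ^ h - 1) = (i - 1) * 3 ^ h + (3 ^ h - 1 - (i - 1))"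
    using assms by (cases i) (auto simp: algebra_simps diff_mult_distrib)
  then have "w3 (i * (3 ^ h - 1)) = w3 (i - 1) + w3 (3 ^ h - 1 - (i - 1))"
    using w3_append[of "3 ^ h - 1 - (i - 1)" h "i - 1"] by simp
  moreover have "i - 1 < 3 ^ h" using assms by linarith
  ultimately show ?thesis using w3_complement[of "i - 1" h] by simp
qed

text \<open>Multiplication by 3 modulo 3^m - 1 rotates the m digits cyclically.\<close>

lemma w3_rotate:
  assumes "j < 3 ^ m - 1"
  shows "w3 (3 * j mod (3 ^ m - 1)) = w3 j"
proof (cases m)
  case (Suc k)
  define t r where "t = j div 3 ^ k" and "r = j mod 3 ^ k"
  have j: "j = t * 3 ^ k + r" and r: "r < 3 ^ k" unfolding t_def r_def by (simp_all only: div_mult_mod_eq) simp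
  have t: "t < 3" using assms unfolding t_def Suc
    by (simp add: less_mult_imp_div_less)
  have e: "3 * j = t * (3 ^ m - 1) + (3 * r + t)"
  proof -
    have "t \<le> t * 3 ^ m" "t * (3 ^ m - 1) = t * 3 ^ m - t" by (simp_all add: diff_mult_distrib2)
    moreover have "3 * j = t * 3 ^ m + 3 * r" using j Suc by simp
    ultimately show ?thesis by linarith
  qed
  \<comment> \<open>The bound could fail only with all digits equal to 2, that is for
    \<open>j = 3 ^ m - 1\<close>, which is excluded.\<close>
  have "3 * r + t < 3 ^ m - 1"
  proof (rule ccontr)
    assume "\<not> ?thesis"
    then have "r = 3 ^ k - 1" "t = 2" using r t Suc by auto
    then show False using j assms Suc r by (simp add: algebra_simps)
  qed
  then have "3 * j mod (3 ^ m - 1) = 3 * r + t" using e by simp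
  then show ?thesis using j r t by (simp add: w3_digit w3_append) (metis add_0 mult_0_right w3_0 w3_digit)
qed (use assms in simp)

section \<open>Counting exponents by their digit sum modulo 4\<close>

definition w3_count :: "nat \<Rightarrow> nat \<Rightarrow> nat" where
  "w3_count m k = card {j. j < 3 ^ m \<and> (w3 j + k) mod 4 < 2}"

lemma w3_count_complement: "w3_count m k + w3_count m (k + 2) = 3 ^ m"
proof -
  have *: "(x + (k + 2)) mod 4 < 2 \<longleftrightarrow> \<not> (x + k) mod 4 < 2" for x :: nat by presburger
  have "{j. j < 3 ^ m} = {j. j < 3 ^ m \<and> (w3 j + k) mod 4 < 2} \<union> {j. j < 3 ^ m \<and> \<not> (w3 j + k) mod 4 < 2}"
    (is "_ = ?A \<union> ?B") by auto
  moreover have "card (?A \<union> ?B) = card ?A + card ?B" by (rule card_Un_disjoint) auto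
  ultimately have "card {j::nat. j < 3 ^ m} = w3_count m k + w3_count m (k + 2)"
    unfolding w3_count_def * by metis
  then show ?thesis by simp
qed

text \<open>Splitting off the last digit d turns the shift k into k + d. The digits 0 and 2 give
  complementary conditions and together contribute 3^m, so only the digit 1 remains.\<close>

lemma w3_count_Suc: "w3_count (Suc m) k = 3 ^ m + w3_count m (k + 1)"
proof -
  let ?B = "\<lambda>d. {j. j < 3 ^ m \<and> (w3 j + (k + d)) mod 4 < 2}"
  have "{j. j < 3 ^ Suc m \<and> (w3 j + k) mod 4 < 2} =
    (\<lambda>j. 3 * j + 0) ` ?B 0 \<union> (\<lambda>j. 3 * j + 1) ` ?B 1 \<union> (\<lambda>j. 3 * j + 2) ` ?B 2" (is "?L = ?R")
  proof (intro equalityI subsetI)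
    fix j assume j: "j \<in> ?L"
    have e: "j = 3 * (j div 3) + j mod 3" by simp
    have "w3 j = w3 (j div 3) + j mod 3" by (metis e w3_digit mod_less_divisor zero_less_numeral)
    then have "j div 3 \<in> ?B (j mod 3)" using j by (auto simp: algebra_simps)
    moreover have "j mod 3 = 0 \<or> j mod 3 = 1 \<or> j mod 3 = 2" by presburger
    ultimately show "j \<in> ?R" using e by (elim disjE) (auto simp: image_iff)
  next
    fix j assume "j \<in> ?R"
    then obtain i d where "j = 3 * i + d" "d < 3" "i \<in> ?B d" by fastforce
    then show "j \<in> ?L" using w3_digit[of d i] by (simp add: ac_simps)
  qed
  moreover have "card ((\<lambda>j. 3 * j + d) ` ?B d') = card (?B d')" for d d'
    by (intro card_image inj_onI) simp
  moreover have "(\<lambda>j. 3 * j + 0) ` ?B 0 \<inter> (\<lambda>j. 3 * j + 1) ` ?B 1 = {}" by (auto; presburger)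
  moreover have "((\<lambda>j. 3 * j + 0) ` ?B 0 \<union> (\<lambda>j. 3 * j + 1) ` ?B 1) \<inter> (\<lambda>j. 3 * j + 2) ` ?B 2 = {}"
    by (auto; presburger)
  moreover have "finite ((\<lambda>j. 3 * j + d) ` ?B d')" for d d' by simp
  ultimately have "w3_count (Suc m) k = w3_count m (k + 0) + w3_count m (k + 1) + w3_count m (k + 2)"
    unfolding w3_count_def by (simp only: card_Un_disjoint finite_Un)
  then show ?thesis using w3_count_complement[of m k] by simp
qed

text \<open>The recursion lowers m and raises k by one, keeping the excess of
  \<open>2 * w3_count m k + 1\<close> over 3^m. It can thus be read off at m = 0.\<close>

lemma w3_count_eq: "2 * w3_count m k + 1 = 3 ^ m + (if (k + m) mod 4 < 2 then 2 else 0)"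
proof (induction m arbitrary: k)
  case 0
  have "{j. j < (3::nat) ^ 0 \<and> (w3 j + k) mod 4 < 2} = (if k mod 4 < 2 then {0} else {})" by auto
  then show ?case by (simp add: w3_count_def)
next
  case (Suc m)
  then show ?case using Suc[of "k + 1"] by (simp add: w3_count_Suc)
qed

section \<open>Power sums and the folding bound\<close>

text \<open>Applying the relations to the polynomial with roots at the other nodes isolates one coefficient.\<close>

lemma power_sums_eq_0_imp_eq_0:
  fixes X y :: "'b \<Rightarrow> 'a::field"
  assumes "finite K" "inj_on X K" "\<And>i. i < card K \<Longrightarrow> (\<Sum>k\<in>K. y k * X k ^ i) = 0" "k \<in> K"
  shows "y k = 0"
proof -
  define f where "f = (\<Prod>l\<in>K - {k}. [:- X l, 1:])"
  have "degree f = (\<Sum>l\<in>K - {k}. degree [:- X l, 1:])"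
    unfolding f_def by (rule degree_prod_sum_eq) auto
  moreover have "0 < card K" using assms(1,4) by (auto simp: card_gt_0_iff)
  ultimately have deg: "degree f < card K" using assms(1,4) by simp
  have "(\<Sum>l\<in>K. y l * poly f (X l)) = (\<Sum>l\<in>K. \<Sum>i\<le>degree f. coeff f i * (y l * X l ^ i))"
    by (simp add: poly_altdef sum_distrib_left mult.left_commute)
  also have "\<dots> = (\<Sum>i\<le>degree f. coeff f i * (\<Sum>l\<in>K. y l * X l ^ i))"
    by (subst sum.swap) (simp only: sum_distrib_left)
  also have "\<dots> = 0" using deg assms(3) by (intro sum.neutral) auto
  finally have "(\<Sum>l\<in>K. y l * poly f (X l)) = 0" .
  moreover have "poly f (X l) = 0" if "l \<in> K - {k}" for l
    using that assms(1) by (auto simp: f_def poly_prod prod_zero_iff)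
  ultimately have "y k * poly f (X k) = 0"
    using sum.remove[OF assms(1,4), of "\<lambda>l. y l * poly f (X l)"] by simp
  moreover have "poly f (X k) \<noteq> 0"
    using assms(1,2,4) by (auto simp: f_def poly_prod prod_zero_iff inj_on_def)
  ultimately show ?thesis by simp
qed

text \<open>This is the BCH bound: on a support of at most L nodes there would be enough vanishing
  power sums to kill every coefficient.\<close>

lemma card_support_gt:
  fixes X y :: "'b \<Rightarrow> 'a::field"
  assumes "finite K" "inj_on X K" "\<And>i. i < L \<Longrightarrow> (\<Sum>k\<in>K. y k * X k ^ i) = 0" "k \<in> K" "y k \<noteq> 0"
  shows "L < card {k \<in> K. y k \<noteq> 0}"
proof (rule ccontr)
  let ?S = "{k \<in> K. y k \<noteq> 0}"
  assume *: "\<not> L < card ?S"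
  have "y k = 0"
  proof (rule power_sums_eq_0_imp_eq_0[where K = ?S and X = X and y = y])
    show "finite ?S" using assms(1) by simp
    show "inj_on X ?S" using assms(2) by (rule inj_on_subset) blast
    show "k \<in> ?S" using assms(4,5) by simp
    fix i assume "i < card ?S"
    moreover have "(\<Sum>k\<in>?S. y k * X k ^ i) = (\<Sum>k\<in>K. y k * X k ^ i)"
      by (rule sum.mono_neutral_left) (use assms(1) in auto)
    ultimately show "(\<Sum>k\<in>?S. y k * X k ^ i) = 0" using assms(3)[of i] * by simp
  qed
  with assms(5) show False by simp
qed

text \<open>The coefficients of the locator polynomial, monic with the roots X k, serve as
  \<open>s\<close>: each k then contributes a multiple of the value of this polynomial at one of its
  roots.\<close>

lemma power_sums_recurrence:
  fixes X y :: "'b \<Rightarrow> 'a::field"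
  assumes "finite K"
  obtains s where "s (card K) = 1"
    "\<And>j. (\<Sum>t\<le>card K. s t * (\<Sum>k\<in>K. y k * X k ^ (j + t))) = 0"
proof -
  define f where "f = (\<Prod>l\<in>K. [:- X l, 1:])"
  have deg: "degree f = card K"
    unfolding f_def by (subst degree_prod_sum_eq) auto
  have "lead_coeff f = 1" unfolding f_def by (simp add: lead_coeff_prod)
  then have "coeff f (card K) = 1" using deg by simp
  moreover have "(\<Sum>t\<le>card K. coeff f t * (\<Sum>k\<in>K. y k * X k ^ (j + t))) = 0" for j
  proof -
    have "(\<Sum>t\<le>card K. coeff f t * (\<Sum>k\<in>K. y k * X k ^ (j + t))) =
        (\<Sum>k\<in>K. \<Sum>t\<le>card K. coeff f t * (y k * X k ^ (j + t)))"
      by (subst sum.swap) (simp only: sum_distrib_left)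
    also have "\<dots> = (\<Sum>k\<in>K. y k * X k ^ j * poly f (X k))"
      by (simp add: poly_altdef sum_distrib_left deg power_add mult_ac)
    also have "\<dots> = 0"
      by (intro sum.neutral) (use assms in \<open>auto simp: f_def poly_prod prod_zero_iff\<close>)
    finally show ?thesis .
  qed
  ultimately show ?thesis by (rule that)
qed

section \<open>Values of words at powers, and folding modulo half of the length\<close>

definition ev :: "'a::{field,finite} \<Rightarrow> nat \<Rightarrow> (nat \<Rightarrow> 'a) \<Rightarrow> nat \<Rightarrow> 'a" where
  "ev \<beta> n v j = (\<Sum>i<n. v i * \<beta> ^ (i * j))"

lemma sum_lessThan_double:
  "(\<Sum>i<2 * N. f i) = (\<Sum>k<N. f k + f (k + N :: nat))"
proof -
  have "(\<Sum>i<2 * N. f i) = (\<Sum>i<N. f i) + (\<Sum>i\<in>{N..<2 * N}. f i)"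
    by (subst sum.union_disjoint[symmetric]) (auto intro: sum.cong)
  also have "(\<Sum>i\<in>{N..<2 * N}. f i) = (\<Sum>k<N. f (k + N))"
    by (rule sum.reindex_bij_witness[of _ "\<lambda>i. i + N" "\<lambda>i. i - N"]) auto
  finally show ?thesis by (simp add: sum.distrib)
qed

text \<open>
  The folded word with entries v(k) + v(k + N) carries the even exponents.  If it vanishes, the two
  halves of the word are opposite, every weight is counted twice, and the odd exponents take over.
\<close>

lemma hweight_folding_bound:
  fixes \<beta> :: "'a::{field,finite}" and v :: "nat \<Rightarrow> 'a"
  assumes half: "\<beta> ^ N = -1" and inj: "inj_on (\<lambda>i. \<beta> ^ i) {..<2 * N}" and two: "(2::'a) \<noteq> 0"
    and u: "even u" "3 * u * (u + 2) + 2 = 2 * N"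
    and even_zeros: "\<And>i. i < L \<Longrightarrow> ev \<beta> (2 * N) v (i * u) = 0"
    and odd_zeros: "\<And>i. i < M \<Longrightarrow> ev \<beta> (2 * N) v (a + i * u) = 0" and a: "odd a"
    and nz: "i0 < 2 * N" "v i0 \<noteq> 0"
  shows "L < hweight (2 * N) v \<or> 2 * (M + 1) \<le> hweight (2 * N) v"
proof -
  have full: "\<beta> ^ (2 * N) = 1" using power_even_eq[of \<beta> N] by (simp add: half)
  have fold: "\<beta> ^ ((k + N) * j) = (if even j then 1 else -1) * \<beta> ^ (k * j)" for k j
    by (simp add: distrib_right power_add power_mult[of _ N] half)
  \<comment> \<open>The relation \<open>3 * u * (u + 2) + 2 = 2 * N\<close> makes
    \<open>k * u * (3 * (u + 2))\<close> congruent to - 2k modulo 2N, so the node determines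
    \<open>\<beta> ^ (2 * k)\<close>, and 2k is below 2N.\<close>
  have X: "inj_on (\<lambda>k. \<beta> ^ (k * u)) {..<N}"
  proof (rule inj_onI)
    fix k l assume kl: "k \<in> {..<N}" "l \<in> {..<N}" and eq: "\<beta> ^ (k * u) = \<beta> ^ (l * u)"
    have inv: "\<beta> ^ (k * u * (3 * (u + 2))) * \<beta> ^ (2 * k) = 1" for k
    proof -
      have "k * u * (3 * (u + 2)) + 2 * k = k * (3 * u * (u + 2) + 2)" by (simp add: algebra_simps)
      also have "\<dots> = 2 * N * k" using u by simp
      finally have "\<beta> ^ (k * u * (3 * (u + 2)) + 2 * k) = 1" using power_mult[of \<beta> "2 * N" k] full by simp
      then show ?thesis by (simp only: power_add)
    qed
    have "\<beta> ^ (2 * k) = \<beta> ^ (2 * l)"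
    proof -
      define z where "z = (\<beta> ^ (k * u)) ^ (3 * (u + 2))"
      have "z * \<beta> ^ (2 * k) = 1" using inv[of k] by (simp only: z_def power_mult[of \<beta> "k * u"])
      moreover have "z * \<beta> ^ (2 * l) = 1" using inv[of l] by (simp only: z_def eq power_mult[of \<beta> "l * u"])
      ultimately have "z \<noteq> 0" "z * \<beta> ^ (2 * k) = z * \<beta> ^ (2 * l)" by auto
      then show ?thesis by (simp only: mult_left_cancel not_False_eq_True)
    qed
    then have "2 * k = 2 * l" using kl by (intro inj_onD[OF inj]) auto
    then show "k = l" by simp
  qed
  define y where "y k = v k + v (k + N)" for k
  show ?thesis
  proof (cases "\<exists>k<N. y k \<noteq> 0")
    case True
    have "(\<Sum>k<N. y k * (\<beta> ^ (k * u)) ^ i) = 0" if "i < L" for i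
    proof -
      have "ev \<beta> (2 * N) v (i * u) = (\<Sum>k<N. y k * (\<beta> ^ (k * u)) ^ i)"
        unfolding ev_def sum_lessThan_double y_def
        by (intro sum.cong refl, simp only: fold) (simp add: u(1) distrib_right mult_ac flip: power_mult)
      with even_zeros[OF that] show ?thesis by simp
    qed
    moreover obtain k where "k \<in> {..<N}" "y k \<noteq> 0" using True by auto
    ultimately have "L < card {k \<in> {..<N}. y k \<noteq> 0}"
      by (intro card_support_gt[OF _ X, where y = y]) auto
    \<comment> \<open>A nonzero folded entry needs a nonzero entry at one of its two
      positions.\<close>
    also have "\<dots> \<le> card ((\<lambda>i. i mod N) ` {i. i < 2 * N \<and> v i \<noteq> 0})"
    proof (rule card_mono)
      show "{k \<in> {..<N}. y k \<noteq> 0} \<subseteq> (\<lambda>i. i mod N) ` {i. i < 2 * N \<and> v i \<noteq> 0}"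
      proof
        fix k assume "k \<in> {k \<in> {..<N}. y k \<noteq> 0}"
        then have k: "k < N" and "v k \<noteq> 0 \<or> v (k + N) \<noteq> 0" by (auto simp: y_def)
        then show "k \<in> (\<lambda>i. i mod N) ` {i. i < 2 * N \<and> v i \<noteq> 0}"
          using image_eqI[of k "\<lambda>i. i mod N" k] image_eqI[of k "\<lambda>i. i mod N" "k + N"] by auto
      qed
    qed auto
    also have "\<dots> \<le> hweight (2 * N) v" unfolding hweight_def by (rule card_image_le) simp
    finally show ?thesis by simp
  next
    case False
    then have opp: "v (k + N) = - v k" if "k < N" for k
      using that minus_unique[of "v k" "v (k + N)"] by (simp add: y_def)
    \<comment> \<open>At odd exponents the sign of \<open>\<beta> ^ N\<close> cancels that of the
      opposite half, so both halves contribute equally. The offset a is absorbed into the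
      coefficients.\<close>
    have "(\<Sum>k<N. (v k * \<beta> ^ (k * a)) * (\<beta> ^ (k * u)) ^ i) = 0" if "i < M" for i
    proof -
      have "odd (a + i * u)" using a u by simp
      then have "ev \<beta> (2 * N) v (a + i * u) = (\<Sum>k<N. 2 * ((v k * \<beta> ^ (k * a)) * (\<beta> ^ (k * u)) ^ i))"
        unfolding ev_def sum_lessThan_double
        by (intro sum.cong refl, simp only: fold) (simp add: opp distrib_left power_add mult_ac flip: power_mult)
      with odd_zeros[OF that] two show ?thesis by (simp flip: sum_distrib_left)
    qed
    moreover obtain k where "k < N" "v k \<noteq> 0"
    proof (cases "i0 < N")
      case False
      then show ?thesis using opp[of "i0 - N"] nz that[of "i0 - N"] by auto
    qed (use nz that in auto)
    moreover have b0: "\<beta> \<noteq> 0" using full nz(1) by (auto simp: power_0_left)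
    ultimately have "M < card {k \<in> {..<N}. v k * \<beta> ^ (k * a) \<noteq> 0}"
      by (intro card_support_gt[OF _ X, where y = "\<lambda>k. v k * \<beta> ^ (k * a)"]) auto
    also have "{k \<in> {..<N}. v k * \<beta> ^ (k * a) \<noteq> 0} = {k. k < N \<and> v k \<noteq> 0}"
      using b0 by auto
    finally have "M < card {k. k < N \<and> v k \<noteq> 0}" .
    moreover have "{i. i < 2 * N \<and> v i \<noteq> 0} = {k. k < N \<and> v k \<noteq> 0} \<union> (\<lambda>k. k + N) ` {k. k < N \<and> v k \<noteq> 0}"
      (is "?A = ?B \<union> ?C")
    proof (intro equalityI subsetI)
      fix i assume i: "i \<in> ?A"
      show "i \<in> ?B \<union> ?C"
      proof (cases "i < N")
        case False
        then have 1: "i = (i - N) + N" "i - N < N" using i by auto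
        moreover from 1 have "v (i - N) \<noteq> 0" using i opp[of "i - N"] by auto
        ultimately show ?thesis by blast
      qed (use i in auto)
    qed (auto simp: opp)
    moreover have "card (?B \<union> ?C) = card ?B + card ?B"
      by (subst card_Un_disjoint) (auto simp: card_image)
    ultimately show ?thesis by (simp add: hweight_def)
  qed
qed

section \<open>The field and its primitive element\<close>

locale ternary_field =
  fixes \<alpha> :: "'a::{field,finite}" and m n :: nat
  assumes m_pos: "0 < m" and card_field: "card (UNIV :: 'a set) = 3 ^ m"
    and primitive: "primitive_elem \<alpha>" and n_def: "n = 3 ^ m - 1"
begin

section \<open>Characteristic 3 and the prime field\<close>

lemma n_ge_2: "2 \<le> n"
  using power_increasing[of 1 m "3::nat"] m_pos by (simp add: n_def)

text \<open>Translation by 1 permutes the field and so preserves the sum of all elements; hence 3^m,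
  and with it 3, vanishes in the field.\<close>

lemma three_eq_0: "(3::'a) = 0"
proof -
  have "(\<Sum>x\<in>UNIV. x) = (\<Sum>x\<in>UNIV. x + (1::'a))"
    by (rule sum.reindex_bij_witness[of _ "\<lambda>x. x + 1" "\<lambda>x. x - 1"]) auto
  then have "of_nat (card (UNIV :: 'a set)) = (0::'a)" by (simp add: sum.distrib)
  then show ?thesis by (simp add: card_field)
qed

lemma CHAR_eq_3: "CHAR('a) = 3"
proof -
  have "CHAR('a) dvd 3" using three_eq_0 by (metis of_nat_eq_0_iff_char_dvd of_nat_numeral)
  moreover have "CHAR('a) \<noteq> 1" by simp
  moreover have "prime (3::nat)" by simp
  ultimately show ?thesis by (auto simp: prime_nat_iff)
qed

lemma two_eq: "(2::'a) = -1"
proof -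
  have "(2::'a) = 3 - 1" by simp
  then show ?thesis by (simp only: three_eq_0 diff_0)
qed

lemma cube_add: "(x + y) ^ 3 = x ^ 3 + (y::'a) ^ 3"
  by (rule freshmans_dream) (simp_all add: CHAR_eq_3)

lemma cube_sum: "(\<Sum>i\<in>I. f i :: 'a) ^ 3 = (\<Sum>i\<in>I. f i ^ 3)"
  by (rule freshmans_dream_sum) (simp_all add: CHAR_eq_3)

lemma prime_field_eq: "range of_int = {0, 1, -1 :: 'a}"
proof
  show "range of_int \<subseteq> {0, 1, -1 :: 'a}"
  proof
    fix x :: 'a assume "x \<in> range of_int"
    then obtain k where "x = of_int k" by auto
    moreover have "of_int k = (of_int (k mod 3) :: 'a)"
    proof -
      have "of_int k = (of_int (3 * (k div 3) + k mod 3) :: 'a)" by simp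
      also have "\<dots> = of_int (k mod 3)" by (simp only: of_int_add of_int_mult of_int_numeral three_eq_0) simp
      finally show ?thesis .
    qed
    moreover have "k mod 3 = 0 \<or> k mod 3 = 1 \<or> k mod 3 = 2" by presburger
    ultimately show "x \<in> {0, 1, -1}" using two_eq by auto
  qed
  show "{0, 1, -1 :: 'a} \<subseteq> range of_int"
    by (auto intro: range_eqI[of _ _ 0] range_eqI[of _ _ 1] range_eqI[of _ _ "-1"])
qed

lemma card_prime_field: "card (range of_int :: 'a set) = 3"
proof -
  have "(-1 :: 'a) \<noteq> 1" using two_eq by (metis one_neq_zero add_eq_0_iff neg_equal_0_iff_equal one_add_one)
  then show ?thesis by (simp add: prime_field_eq eq_commute[of 1])
qed

text \<open>The polynomial x^3 - x factors as x (x - 1) (x + 1). Having entries in the prime field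
  thus becomes invariance under the Frobenius map.\<close>

lemma in_prime_field_iff: "(x::'a) \<in> range of_int \<longleftrightarrow> x ^ 3 = x"
proof -
  have "x ^ 3 = x \<longleftrightarrow> x * (x - 1) * (x + 1) = 0" by (auto simp: power3_eq_cube algebra_simps)
  then show ?thesis by (auto simp: prime_field_eq eq_neg_iff_add_eq_0)
qed

section \<open>The order of the primitive element and the orthogonality of its powers\<close>

lemma alpha_nz [simp]: "\<alpha> \<noteq> 0"
  using primitive by (simp add: primitive_elem_def)

text \<open>For the least positive d with \<open>\<alpha> ^ d = 1\<close> the first d powers are
  distinct and exhaust the nonzero elements, so d is their number.\<close>

lemma alpha_order: "\<alpha> ^ n = 1" "inj_on (\<lambda>i. \<alpha> ^ i) {..<n}"
proof -
  have "\<not> inj (\<lambda>i::nat. \<alpha> ^ i)" using finite_imageD[of "\<lambda>i::nat. \<alpha> ^ i" UNIV] by auto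
  then obtain i j where "i \<noteq> j" "\<alpha> ^ i = \<alpha> ^ (j::nat)" by (auto simp: inj_def)
  then obtain i j :: nat where ij: "i < j" "\<alpha> ^ i = \<alpha> ^ j" by (metis linorder_neqE_nat)
  have cancel: "\<alpha> ^ (j - i) = 1" if "i < j" "\<alpha> ^ i = \<alpha> ^ j" for i j
  proof -
    have "\<alpha> ^ j = \<alpha> ^ i * \<alpha> ^ (j - i)" using that(1) by (simp flip: power_add)
    then have "\<alpha> ^ i * \<alpha> ^ (j - i) = \<alpha> ^ i * 1" using that(2) by simp
    then show ?thesis by (simp only: mult_left_cancel power_not_zero[OF alpha_nz] not_False_eq_True)
  qed
  with ij have ex: "\<exists>d>0. \<alpha> ^ d = 1" by (intro exI[of _ "j - i"]) auto
  define d where "d = (LEAST d. d > 0 \<and> \<alpha> ^ d = 1)"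
  have d: "d > 0" "\<alpha> ^ d = 1" using LeastI_ex[OF ex] by (auto simp: d_def)
  have inj: "inj_on (\<lambda>i. \<alpha> ^ i) {..<d}"
  proof (rule linorder_inj_onI)
    fix i j assume "i < j" "i \<in> {..<d}" "j \<in> {..<d}"
    then show "\<alpha> ^ i \<noteq> \<alpha> ^ j"
      using cancel[of i j] not_less_Least[of "j - i" "\<lambda>d. d > 0 \<and> \<alpha> ^ d = 1"] by (auto simp: d_def[symmetric])
  qed auto
  have "- {0} = (\<lambda>i. \<alpha> ^ i) ` {..<d}"
  proof (intro equalityI subsetI)
    fix x assume "x \<in> - {0::'a}"
    then obtain j where "x = \<alpha> ^ j" using primitive by (auto simp: primitive_elem_def)
    also have "\<alpha> ^ j = \<alpha> ^ (j mod d)"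
      by (metis d(2) div_mult_mod_eq mult.commute mult_1 power_add power_mult power_one)
    finally show "x \<in> (\<lambda>i. \<alpha> ^ i) ` {..<d}" using d by auto
  qed auto
  then have "card (- {0::'a}) = d" using inj by (simp add: card_image)
  moreover have "card (- {0::'a}) = n" by (simp add: card_field n_def Compl_eq_Diff_UNIV)
  ultimately show "\<alpha> ^ n = 1" "inj_on (\<lambda>i. \<alpha> ^ i) {..<n}" using d inj by auto
qed

lemma alpha_power_mod: "\<alpha> ^ (j mod n) = \<alpha> ^ j"
  by (metis alpha_order(1) div_mult_mod_eq mult.commute mult_1 power_add power_mult power_one)

lemma alpha_power_eq_iff: "\<alpha> ^ i = \<alpha> ^ j \<longleftrightarrow> i mod n = j mod n"
  using inj_onD[OF alpha_order(2), of "i mod n" "j mod n"] n_ge_2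
  by (metis alpha_power_mod lessThan_iff mod_less_divisor order_less_le_trans pos2)

lemma alpha_power_eq_1_iff: "\<alpha> ^ j = 1 \<longleftrightarrow> n dvd j"
  using alpha_power_eq_iff[of j 0] by (simp add: dvd_eq_mod_eq_0)

lemma power_card: "x ^ 3 ^ m = (x::'a)"
proof (cases "x = 0")
  case False
  then obtain j where j: "x = \<alpha> ^ j" using primitive by (auto simp: primitive_elem_def)
  have "x ^ n = 1" unfolding j by (metis alpha_order(1) mult.commute power_mult power_one)
  moreover have "3 ^ m = Suc n" by (simp add: n_def)
  ultimately show ?thesis by simp
qed simp

lemma of_nat_n: "of_nat n = (-1 :: 'a)"
proof -
  have "of_nat (n + 1) = (0 :: 'a)" using m_pos by (simp add: n_def three_eq_0)
  then show ?thesis by (simp add: eq_neg_iff_add_eq_0 add.commute)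
qed

text \<open>A geometric sum; when the ratio is 1, all n terms are 1, and n equals - 1 in
  characteristic 3.\<close>

lemma sum_alpha_powers: "(\<Sum>i<n. \<alpha> ^ (i * j)) = (if n dvd j then - 1 else 0)"
proof (cases "n dvd j")
  case True
  then have "\<alpha> ^ (i * j) = 1" for i by (simp add: alpha_power_eq_1_iff)
  then show ?thesis using True of_nat_n by simp
next
  case False
  have "(\<Sum>i<n. (\<alpha> ^ j) ^ i) = 0"
    using False geometric_sum[of "\<alpha> ^ j" n] alpha_power_eq_1_iff[of j] alpha_power_eq_1_iff[of "j * n"]
    by (simp flip: power_mult)
  then show ?thesis using False by (simp add: mult.commute flip: power_mult)
qed

end

section \<open>Locators of degree 7 over the field with 27 elements\<close>

lemma F27_no_root_aux:
  fixes s :: "'a::field"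
  assumes three: "(3::'a) = 0" and s27: "s ^ 27 = s"
  shows "s ^ 9 - s ^ 7 - s ^ 5 + s ^ 3 \<noteq> 1"
proof
  assume f: "s ^ 9 - s ^ 7 - s ^ 5 + s ^ 3 = 1"
  \<comment> \<open>a Bezout relation modulo 3 between the two polynomials of which s would be a common root\<close>
  have "(s ^ 25 + s ^ 23 + s ^ 22 + s ^ 21 + s ^ 20 + s ^ 16 - s ^ 15 + s ^ 14 + s ^ 9 - s ^ 8 - s ^ 7 + s ^ 6 + s ^ 5 - s ^ 3 - s ^ 2 + s - 1) * (s ^ 9 - s ^ 7 - s ^ 5 + s ^ 3 - 1)
      + (- (s ^ 7) - s ^ 4 + s ^ 3 + s - 1) * (s ^ 27 - s)
      = 1 + 3 * (- (s ^ 27) - s ^ 21 - s ^ 16 + s ^ 15 - s ^ 11 + s ^ 8 + s ^ 7 - s ^ 6)"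
    by (simp add: algebra_simps power2_eq_square flip: power_add power_Suc)
  then show False by (simp only: f s27 three) simp
qed

text \<open>The polynomial is odd, so the value - 1 at s is the value 1 at - s.\<close>

lemma F27_no_root:
  fixes s :: "'a::field"
  assumes three: "(3::'a) = 0" and F27: "\<And>x::'a. x ^ 27 = x"
  shows "(s ^ 9 - s ^ 7 - s ^ 5 + s ^ 3)\<^sup>2 \<noteq> 1"
proof
  assume "(s ^ 9 - s ^ 7 - s ^ 5 + s ^ 3)\<^sup>2 = 1"
  then have "s ^ 9 - s ^ 7 - s ^ 5 + s ^ 3 = 1 \<or> (- s) ^ 9 - (- s) ^ 7 - (- s) ^ 5 + (- s) ^ 3 = 1"
    by (auto simp: power2_eq_1_iff algebra_simps)
  then show False using F27_no_root_aux[OF three F27] by blast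
qed

text \<open>
  The sequence A plays the role of the values of a word at the powers of a primitive element of the
  field with 27 elements, and s of the coefficients of a locator polynomial of degree 7.
\<close>

lemma no_locator_of_degree_7_normalized:
  fixes A s :: "nat \<Rightarrow> 'a::field"
  assumes three: "(3::'a) = 0" and F27: "\<And>x::'a. x ^ 27 = x"
    and per: "\<And>j. A (j + 26) = A j" and cube: "\<And>j. A (3 * j) = A j ^ 3"
    and zeros: "A 0 = 0" "A 1 = 0" "A 8 = 0" "A 14 = 0" "A 17 = 0"
    and locator: "s 7 = 1" "\<And>j. (\<Sum>t\<le>7. s t * A (j + t)) = 0"
    and A2: "A 2 = 1"
  shows False
proof -
  define b c d S where "b = A 4" and "c = A 5" and "d = A 7" and "S = - s 0"
  \<comment> \<open>Cubing determines A along an orbit of multiplication by 3 modulo 26 from a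
    single value; \<open>b\<close>, \<open>c\<close> and \<open>d\<close> represent the orbits of 4,
    5 and 7.\<close>
  have A: "A 3 = 0" "A 6 = 1" "A 18 = 1" "A 16 = 0" "A 19 = c ^ 9" "A 20 = 0" "A 21 = d ^ 3" "A 22 = 0"
    "A 23 = 0" "A 24 = 0" "A 25 = 0" "A 26 = 0" "A 27 = 0" "A 28 = 1" "A 29 = 0" "A 30 = b" "A 31 = c"
    "A 32 = 1"
    using cube[of 1] cube[of 2] cube[of 6] cube[of 14] cube[of 5] cube[of 15] cube[of 8] cube[of 24]
      cube[of 7] cube[of 16] cube[of 17] cube[of 25] cube[of 23] A2 zeros
      per[of 16] per[of 19] per[of 20] per[of 46] per[of 22] per[of 25] per[of 49] per[of 23]
      per[of 0] per[of 1] per[of 2] per[of 3] per[of 4] per[of 5] per[of 6]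
    by (simp_all add: b_def c_def d_def flip: power_mult)
  have rec: "s 0 * A j + s 1 * A (j + 1) + s 2 * A (j + 2) + s 3 * A (j + 3) + s 4 * A (j + 4)
      + s 5 * A (j + 5) + s 6 * A (j + 6) + A (j + 7) = 0" for j
    using locator(2)[of j] locator(1) by (simp add: eval_nat_numeral)
  \<comment> \<open>As \<open>A 22\<close> to \<open>A 27\<close> vanish, the recurrences at 18 to
    24 can be solved for one coefficient at a time. The one at 21 makes S the inverse of
    d^3.\<close>
  have e21: "S * d ^ 3 = 1" using rec[of 21] by (simp add: A S_def zeros minus_equation_iff[of _ 1] minus_unique add.commute)
  then have d0: "d \<noteq> 0" by auto
  have s0: "s 0 = - S" by (simp add: S_def)
  have s1: "s 1 = 0" using rec[of 20] d0 by (simp add: A)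
  have s6: "s 6 = 0" using rec[of 22] by (simp add: A)
  have s5: "s 5 = - b" using rec[of 23] s6 by (simp add: A eq_neg_iff_add_eq_0)
  have s4: "s 4 = - c" using rec[of 24] s6 s5 by (simp add: A eq_neg_iff_add_eq_0)
  have div: "x = y * S" if "x * d ^ 3 = y" for x y
  proof -
    have "x = x * (S * d ^ 3)" by (simp only: e21 mult_1_right)
    also have "\<dots> = y * S" by (simp only: mult_ac flip: that)
    finally show ?thesis .
  qed
  have "s 2 * d ^ 3 = S * c ^ 9" using rec[of 19] s0 s1 by (simp add: A)
  then have s2: "s 2 = S\<^sup>2 * c ^ 9" by (auto dest!: div simp: power2_eq_square mult_ac)
  have "s 3 * d ^ 3 = S" using rec[of 18] s0 s1 s2 by (simp add: A)
  from div[OF this] have s3: "s 3 = S\<^sup>2" by (simp only: power2_eq_square)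
  \<comment> \<open>All coefficients are known by now, so the remaining recurrences are equations in
    b, c, d and S alone.\<close>
  have e17: "S\<^sup>2 * c ^ 18 = c * d ^ 3"
    using rec[of 17] s1 s2 s3 s4 zeros by (simp add: A mult.assoc flip: power_add)
  have e25: "S\<^sup>2 - b\<^sup>2 + 1 = 0"
    using rec[of 25] s3 s4 s5 s6 by (simp add: A b_def[symmetric] c_def[symmetric] power2_eq_square algebra_simps)
  have e0: "s 2 + s 4 * b + s 5 * c + d = 0"
    using rec[of 0] s6 zeros A2 by (simp add: A b_def[symmetric] c_def[symmetric] d_def[symmetric] flip: numeral_2_eq_2)
  have e1: "S\<^sup>2 * b - c\<^sup>2 - b = 0"
    using rec[of 1] s1 s3 s4 s5 s6 zeros A2
    by (simp add: A b_def[symmetric] c_def[symmetric] d_def[symmetric] power2_eq_square algebra_simps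
      flip: numeral_2_eq_2 numeral_3_eq_3)
  have c0: "c \<noteq> 0" using e0 s2 s4 d0 by auto
  have "S ^ 3 * c ^ 18 = c" using e17 e21 by algebra
  moreover have "c ^ 18 = c * c ^ 17" by (simp flip: power_Suc)
  ultimately have "c * (S ^ 3 * c ^ 17) = c * 1" by (simp only: mult.left_commute mult_1_right)
  then have e17': "S ^ 3 * c ^ 17 = 1" using c0 by (simp only: mult_left_cancel not_False_eq_True)
  \<comment> \<open>Squaring \<open>e17'\<close> and using c^27 = c leaves c^8, the fourth power of
    c^2. There b enters only as b^4, so \<open>e1\<close> and \<open>e25\<close> eliminate both b
    and c.\<close>
  have "c ^ 34 = c ^ 27 * c ^ 7" by (simp flip: power_add)
  then have "c ^ 34 = c ^ 8" by (simp only: F27 flip: power_Suc) simp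
  moreover have "(S ^ 3 * c ^ 17)\<^sup>2 = S ^ 6 * c ^ 34" by (simp add: power_mult_distrib flip: power_mult)
  ultimately have "S ^ 6 * c ^ 8 = 1" using e17' by simp
  moreover have "c\<^sup>2 = b * (S\<^sup>2 - 1)" "b\<^sup>2 = S\<^sup>2 + 1" using e1 e25 by algebra+
  then have "c ^ 8 = ((S\<^sup>2 + 1) * (S\<^sup>2 - 1)\<^sup>2)\<^sup>2" by algebra
  ultimately have "(S ^ 9 - S ^ 7 - S ^ 5 + S ^ 3)\<^sup>2 = 1" by algebra
  with F27_no_root[OF three F27] show False by blast
qed

text \<open>Dividing all nodes by z divides \<open>A j\<close> by z^j and rescales the locator. With
  the factor e the value at 2 becomes 1, and the cubing relation survives because e^3 = e.\<close>

lemma no_locator_of_degree_7: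
  fixes A s :: "nat \<Rightarrow> 'a::field"
  assumes three: "(3::'a) = 0" and F27: "\<And>x::'a. x ^ 27 = x"
    and per: "\<And>j. A (j + 26) = A j" and cube: "\<And>j. A (3 * j) = A j ^ 3"
    and zeros: "A 0 = 0" "A 1 = 0" "A 8 = 0" "A 14 = 0" "A 17 = 0"
    and locator: "s 7 = 1" "\<And>j. (\<Sum>t\<le>7. s t * A (j + t)) = 0"
    and e: "e ^ 3 = e" "e * A 2 = z\<^sup>2" and z: "z \<noteq> 0"
  shows False
proof (rule no_locator_of_degree_7_normalized[of "\<lambda>j. e * A j / z ^ j" "\<lambda>t. s t * z ^ t / z ^ 7"])
  have "z * z ^ 26 = z * 1" using F27[of z] by (simp flip: power_Suc)
  then have "z ^ 26 = 1" using z by (simp only: mult_left_cancel not_False_eq_True)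
  then show "e * A (j + 26) / z ^ (j + 26) = e * A j / z ^ j" for j by (simp add: per power_add)
  show "e * A (3 * j) / z ^ (3 * j) = (e * A j / z ^ j) ^ 3" for j
    by (simp add: cube e(1) power_mult_distrib power_divide mult.commute[of j] flip: power_mult)
  show "(\<Sum>t\<le>7. s t * z ^ t / z ^ 7 * (e * A (j + t) / z ^ (j + t))) = 0" for j
  proof -
    have "(\<Sum>t\<le>7. s t * z ^ t / z ^ 7 * (e * A (j + t) / z ^ (j + t)))
      = (\<Sum>t\<le>7. e / z ^ (7 + j) * (s t * A (j + t)))"
      using z by (intro sum.cong refl) (simp add: power_add)
    then show ?thesis by (simp only: locator(2) mult_zero_right flip: sum_distrib_left)
  qed
qed (use assms in auto)

section \<open>Words with prescribed zeros\<close>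

lemma prod_linear_dvd_iff:
  fixes f :: "'b \<Rightarrow> 'a::field"
  assumes "finite T" "inj_on f T"
  shows "(\<Prod>j\<in>T. [:- f j, 1:]) dvd p \<longleftrightarrow> (\<forall>j\<in>T. poly p (f j) = 0)"
  using assms
proof (induction T arbitrary: p rule: finite_induct)
  case (insert x T)
  have *: "(\<forall>j\<in>T. poly q (f j) = 0) \<longleftrightarrow> (\<forall>j\<in>T. poly ([:- f x, 1:] * q) (f j) = 0)" for q
    using insert.hyps insert.prems by (auto simp: inj_on_def)
  show ?case
  proof
    assume "(\<Prod>j\<in>insert x T. [:- f j, 1:]) dvd p"
    then obtain q where "p = (\<Prod>j\<in>insert x T. [:- f j, 1:]) * q" by (elim dvdE)
    then have p: "p = [:- f x, 1:] * ((\<Prod>j\<in>T. [:- f j, 1:]) * q)"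
      by (simp only: prod.insert[OF insert.hyps] mult.assoc)
    have "\<forall>j\<in>T. poly ((\<Prod>j\<in>T. [:- f j, 1:]) * q) (f j) = 0"
      using insert.IH[of "(\<Prod>j\<in>T. [:- f j, 1:]) * q"] insert.prems by simp
    then have "\<forall>j\<in>T. poly p (f j) = 0" unfolding p using * by blast
    moreover have "poly p (f x) = 0" by (simp add: p)
    ultimately show "\<forall>j\<in>insert x T. poly p (f j) = 0" by simp
  next
    assume r: "\<forall>j\<in>insert x T. poly p (f j) = 0"
    then obtain q where p: "p = [:- f x, 1:] * q" by (auto simp: poly_eq_0_iff_dvd elim: dvdE)
    have "\<forall>j\<in>T. poly q (f j) = 0" using r * unfolding p by blast
    then have "(\<Prod>j\<in>T. [:- f j, 1:]) dvd q" using insert by simp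
    then show "(\<Prod>j\<in>insert x T. [:- f j, 1:]) dvd p" unfolding p
      by (simp only: prod.insert[OF insert.hyps] mult_dvd_mono dvd_refl)
  qed
qed simp

lemma coeff_poly_of_word: "v \<in> words n \<Longrightarrow> coeff (poly_of_word n v) i = v i"
  by (auto simp: poly_of_word_def words_def coeff_sum if_distrib cong: if_cong)

lemma poly_poly_of_word: "poly (poly_of_word n v) (\<beta> ^ j) = ev \<beta> n v j"
  by (simp add: poly_of_word_def ev_def poly_sum poly_monom mult.commute flip: power_mult)

context ternary_field
begin

section \<open>The Frobenius map on polynomials, and counting words with prescribed zeros\<close>

definition frob :: "'a poly \<Rightarrow> 'a poly" where
  "frob p = map_poly (\<lambda>x. x ^ 3) p"

lemma coeff_frob: "coeff (frob p) i = coeff p i ^ 3"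
  by (simp add: frob_def coeff_map_poly)

lemma frob_mult: "frob (p * q) = frob p * frob q"
  by (rule poly_eqI) (simp add: coeff_frob coeff_mult cube_sum power_mult_distrib)

lemma frob_linear: "frob [:- a, 1:] = [:- (a ^ 3), 1:]"
  by (rule poly_eqI) (auto simp: coeff_frob coeff_pCons split: nat.split)

lemma frob_prod: "frob (\<Prod>j\<in>J. f j) = (\<Prod>j\<in>J. frob (f j))"
proof (induction J rule: infinite_finite_induct)
  case (insert x F)
  then show ?case by (simp add: frob_mult)
qed (auto intro!: poly_eqI simp: coeff_frob coeff_1)

lemma cube_inj: "x ^ 3 = y ^ 3 \<Longrightarrow> x = (y::'a)"
  using cube_add[of "x - y" y] by simp

lemma words_iff: "v \<in> words N \<longleftrightarrow> (\<forall>i. v i ^ 3 = (v i :: 'a)) \<and> (\<forall>i\<ge>N. v i = 0)"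
  by (simp only: words_def mem_Collect_eq in_prime_field_iff)

lemma poly_of_word_coeff:
  assumes "\<forall>i\<ge>N. coeff p i = 0"
  shows "poly_of_word N (coeff p) = (p :: 'a poly)"
  by (rule poly_eqI) (use assms in \<open>auto simp: poly_of_word_def coeff_sum if_distrib cong: if_cong\<close>)

lemma card_words: "card (words k :: (nat \<Rightarrow> 'a) set) = 3 ^ k"
proof -
  have z: "(0::'a) \<in> range of_int" by (simp add: prime_field_eq)
  have "bij_betw (\<lambda>f. restrict f {..<k}) (words k) ({..<k} \<rightarrow>\<^sub>E (range of_int :: 'a set))"
    by (rule bij_betw_byWitness[where f' = "\<lambda>f i. if i < k then f i else 0"])
      (use z in \<open>auto simp: words_def fun_eq_iff PiE_def extensional_def Pi_def\<close>)
  then have "card (words k :: (nat \<Rightarrow> 'a) set) = card ({..<k} \<rightarrow>\<^sub>E (range of_int :: 'a set))"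
    by (rule bij_betw_same_card)
  then show ?thesis by (simp add: card_PiE card_prime_field)
qed

lemma ev_cong: "i mod n = j mod n \<Longrightarrow> ev \<alpha> n v i = ev \<alpha> n v j"
  unfolding ev_def
  by (intro sum.cong refl arg_cong2[where f = "(*)"]) (metis alpha_power_eq_iff mod_mult_right_eq)

text \<open>Multiplication by 3 is injective modulo n, hence permutes Z, and the Frobenius map
  merely permutes the linear factors.\<close>

lemma cube_closed_prod:
  assumes "Z \<subseteq> {..<n}" "\<And>j. j \<in> Z \<Longrightarrow> 3 * j mod n \<in> Z"
  shows "frob (\<Prod>j\<in>Z. [:- (\<alpha> ^ j), 1:]) = (\<Prod>j\<in>Z. [:- (\<alpha> ^ j), 1:])"
proof -
  have fin: "finite Z" using assms(1) finite_subset by blast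
  have "inj_on (\<lambda>j. 3 * j mod n) Z"
  proof (rule inj_onI)
    fix i j assume "i \<in> Z" "j \<in> Z" "3 * i mod n = 3 * j mod n"
    then have "\<alpha> ^ (i * 3) = \<alpha> ^ (j * 3)" by (simp add: alpha_power_eq_iff mult.commute)
    then have "\<alpha> ^ i = \<alpha> ^ j" by (simp only: power_mult cube_inj)
    then show "i = j" using \<open>i \<in> Z\<close> \<open>j \<in> Z\<close> assms(1) inj_onD[OF alpha_order(2)] by blast
  qed
  moreover from this have "(\<lambda>j. 3 * j mod n) ` Z = Z"
    using assms(2) fin by (intro endo_inj_surj) auto
  ultimately have bij: "bij_betw (\<lambda>j. 3 * j mod n) Z Z" by (simp add: bij_betw_def)
  have "frob (\<Prod>j\<in>Z. [:- (\<alpha> ^ j), 1:]) = (\<Prod>j\<in>Z. [:- (\<alpha> ^ (3 * j mod n)), 1:])"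
    by (simp add: frob_prod frob_linear alpha_power_mod mult.commute flip: power_mult)
  also have "\<dots> = (\<Prod>j\<in>Z. [:- (\<alpha> ^ j), 1:])"
    using prod.reindex_bij_betw[OF bij, of "\<lambda>j. [:- (\<alpha> ^ j), 1:]"] .
  finally show ?thesis .
qed

text \<open>These words are the multiples of the product of the linear factors over Z. That product
  has coefficients in the prime field, so the cofactor is an arbitrary polynomial over the prime
  field with n - card Z coefficients.\<close>

lemma card_words_with_zeros:
  assumes "Z \<subseteq> {..<n}" "\<And>j. j \<in> Z \<Longrightarrow> 3 * j mod n \<in> Z"
  shows "card {v \<in> words n. \<forall>j\<in>Z. ev \<alpha> n v j = 0} = 3 ^ (n - card Z)"
proof -
  define h where "h = (\<Prod>j\<in>Z. [:- (\<alpha> ^ j), 1:])"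
  have fin: "finite Z" using assms(1) finite_subset by blast
  have inj: "inj_on (\<lambda>j. \<alpha> ^ j) Z" using alpha_order(2) assms(1) inj_on_subset by blast
  have h0: "h \<noteq> 0" unfolding h_def using fin by (simp add: prod_zero_iff)
  have degh: "degree h = card Z" unfolding h_def by (subst degree_prod_sum_eq) auto
  have frobh: "frob h = h" unfolding h_def by (rule cube_closed_prod[OF assms])
  have dvd: "h dvd p \<longleftrightarrow> (\<forall>j\<in>Z. poly p (\<alpha> ^ j) = 0)" for p
    unfolding h_def by (rule prod_linear_dvd_iff[OF fin inj])
  let ?W = "words (n - card Z) :: (nat \<Rightarrow> 'a) set"
  let ?C = "{v \<in> words n. \<forall>j\<in>Z. ev \<alpha> n v j = 0}"
  let ?F = "\<lambda>w. coeff (h * poly_of_word (n - card Z) w)"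
  have "bij_betw ?F ?W ?C"
  proof (rule bij_betw_imageI)
    show "inj_on ?F ?W"
    proof (rule inj_onI)
      fix w w' assume w: "w \<in> ?W" "w' \<in> ?W" and "?F w = ?F w'"
      then have "poly_of_word (n - card Z) w = poly_of_word (n - card Z) w'"
        using h0 by (simp add: coeff_inject)
      then show "w = w'" using w by (metis coeff_poly_of_word ext)
    qed
    show "?F ` ?W = ?C"
    proof (intro equalityI subsetI)
      fix v assume "v \<in> ?F ` ?W"
      then obtain w where w: "w \<in> ?W" and v: "v = ?F w" by auto
      let ?q = "poly_of_word (n - card Z) w"
      have "frob ?q = ?q"
        using w by (intro poly_eqI) (simp add: coeff_frob coeff_poly_of_word words_iff)
      then have "v i ^ 3 = v i" for i
        unfolding v using frobh by (metis coeff_frob frob_mult)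
      moreover have v0: "v i = 0" if "i \<ge> n" for i
      proof (cases "?q = 0")
        case False
        have "degree ?q < n - card Z"
          using w False by (metis coeff_poly_of_word leading_coeff_0_iff linorder_not_less words_iff)
        then have "degree (h * ?q) < n" using h0 False degh by (simp add: degree_mult_eq)
        then show ?thesis unfolding v using that by (simp add: coeff_eq_0)
      qed (simp add: v)
      ultimately have "v \<in> words n" by (simp add: words_iff)
      moreover have "poly_of_word n v = h * ?q"
        unfolding v by (rule poly_of_word_coeff) (use v0 v in auto)
      then have "ev \<alpha> n v j = 0" if "j \<in> Z" for j
        using dvd[of "h * ?q"] that by (simp flip: poly_poly_of_word)
      ultimately show "v \<in> ?C" by simp
    next
      fix v assume v: "v \<in> ?C"
      let ?p = "poly_of_word n v"
      have "h dvd ?p" using v by (simp add: dvd poly_poly_of_word)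
      then obtain q where q: "?p = h * q" by (elim dvdE)
      have "frob ?p = ?p"
        using v by (intro poly_eqI) (simp add: coeff_frob coeff_poly_of_word words_iff)
      \<comment> \<open>The Frobenius map fixes the word and \<open>h\<close>, hence also the
        quotient.\<close>
      then have "h * frob q = h * q" unfolding q by (simp add: frob_mult frobh)
      then have "frob q = q" using h0 by simp
      then have "coeff q i ^ 3 = coeff q i" for i by (metis coeff_frob)
      moreover have q0: "coeff q i = 0" if "i \<ge> n - card Z" for i
      proof (cases "q = 0")
        case False
        have "?p \<noteq> 0" using q h0 False by simp
        then have "degree ?p < n"
          using v by (metis (no_types, lifting) coeff_poly_of_word leading_coeff_0_iff linorder_not_less mem_Collect_eq words_iff)
        then have "degree q < n - card Z" using h0 False degh q by (simp add: degree_mult_eq)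
        then show ?thesis using that by (simp add: coeff_eq_0)
      qed simp
      ultimately have "coeff q \<in> ?W" by (simp add: words_iff)
      moreover have "?F (coeff q) = v"
        using q0 q v by (auto simp: poly_of_word_coeff coeff_poly_of_word simp flip: q)
      ultimately show "v \<in> ?F ` ?W" by (metis image_eqI)
    qed
  qed
  then have "card ?W = card ?C" by (rule bij_betw_same_card)
  then show ?thesis by (simp add: card_words)
qed

end

section \<open>The dual code\<close>

text \<open>For odd m the number 2m is 2 modulo 4, so negating an exponent sends the residue a of
  its digit sum to 2 - a: 0 and 2 are exchanged, 1 and 3 are fixed.\<close>

lemma mod_4_complement:
  fixes a b m :: nat
  assumes "a + b = 2 * m" "odd m"
  shows "a mod 4 = 0 \<or> a mod 4 = 3 \<longleftrightarrow> \<not> b mod 4 < 2"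
  using assms by presburger

context ternary_field
begin

lemma gen_poly_dvd_iff:
  "gen_poly \<alpha> i1 i2 m dvd poly_of_word n c \<longleftrightarrow> (\<forall>t\<in>T_set i1 i2 m. ev \<alpha> n c t = 0)"
proof -
  have sub: "T_set i1 i2 m \<subseteq> {..<n}" using n_ge_2 by (auto simp: T_set_def n_def)
  then have "finite (T_set i1 i2 m)" using finite_subset by blast
  moreover have "inj_on (\<lambda>j. \<alpha> ^ j) (T_set i1 i2 m)" using inj_on_subset[OF alpha_order(2) sub] .
  ultimately show ?thesis
    unfolding gen_poly_def using prod_linear_dvd_iff[of "T_set i1 i2 m" "\<lambda>j. \<alpha> ^ j"]
    by (simp add: poly_poly_of_word)
qed

lemma w3_neg: "j \<le> n \<Longrightarrow> w3 (n - j) + w3 j = 2 * m"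
  using w3_complement[of j m] n_ge_2 by (simp add: n_def)

lemma w3_rotate_power: "j < n \<Longrightarrow> w3 (j * 3 ^ s mod n) = w3 j"
proof (induction s)
  case (Suc s)
  have "j * 3 ^ Suc s mod n = 3 * (j * 3 ^ s mod n) mod n"
    by (simp add: mod_mult_right_eq mult_ac)
  also have "w3 \<dots> = w3 (j * 3 ^ s mod n)"
    unfolding n_def by (rule w3_rotate) (use n_ge_2 in \<open>simp add: n_def\<close>)
  finally show ?case using Suc by simp
qed simp

text \<open>The trace is a nonzero polynomial of degree at most 3^(m-1), too small to vanish on all
  3^m elements.\<close>

lemma trace_nonzero: "\<exists>x::'a. (\<Sum>s<m. x ^ 3 ^ s) \<noteq> 0"
proof (rule ccontr)
  assume *: "\<not> ?thesis"
  define p :: "'a poly" where "p = (\<Sum>s<m. monom 1 (3 ^ s))"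
  have "coeff p 1 = (\<Sum>s<m. if s = 0 then 1 else 0)"
    unfolding p_def coeff_sum by (intro sum.cong) auto
  also have "\<dots> = 1" using m_pos by simp
  finally have p0: "p \<noteq> 0" by auto
  have "degree p \<le> 3 ^ (m - 1)"
    unfolding p_def by (intro degree_sum_le) (auto intro!: order.trans[OF degree_monom_le] power_increasing)
  moreover have "{x. poly p x = 0} = UNIV" using * by (auto simp: p_def poly_sum poly_monom)
  then have "3 ^ m \<le> degree p" using card_poly_roots_bound[OF p0] card_field by simp
  ultimately have "(3::nat) ^ m \<le> 3 ^ (m - 1)" by linarith
  then show False using m_pos by simp
qed

lemma power_3_sum: "(\<Sum>i\<in>I. f i :: 'a) ^ 3 ^ s = (\<Sum>i\<in>I. f i ^ 3 ^ s)"
  by (induction s) (simp_all add: power_mult mult.commute[of 3] cube_sum)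

lemma prime_field_power: "x ^ 3 = x \<Longrightarrow> x ^ 3 ^ s = (x::'a)"
  by (induction s) (simp_all add: power_mult mult.commute[of 3])

text \<open>The factor n - 1 stands for negation modulo n, so that exponents stay natural
  numbers.\<close>

lemma pred_n_mult: "(n - 1) * k + k = n * k"
  using n_ge_2 by (cases n) auto

text \<open>After expanding both factors and summing over j first, orthogonality leaves only the
  terms with i = k.\<close>

lemma parseval:
  "(\<Sum>j<n. ev \<alpha> n v j * ev \<alpha> n c ((n - 1) * j)) = - (\<Sum>i<n. v i * c i)"
proof -
  have dvd: "n dvd i + (n - 1) * k \<longleftrightarrow> i = k" if "i < n" "k < n" for i k
  proof -
    have e: "i + (n - 1) * k + k = i + n * k" using pred_n_mult[of k] by linarith
    show ?thesis
    proof
      assume "n dvd i + (n - 1) * k"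
      then obtain q where "i + (n - 1) * k = n * q" by (elim dvdE)
      then have "(n * q + k) mod n = (i + n * k) mod n" using e by simp
      then show "i = k" using that by simp
    qed (use e in \<open>simp add: add.commute\<close>)
  qed
  have "(\<Sum>j<n. ev \<alpha> n v j * ev \<alpha> n c ((n - 1) * j))
    = (\<Sum>j<n. \<Sum>i<n. \<Sum>k<n. v i * c k * \<alpha> ^ (j * (i + (n - 1) * k)))"
    unfolding ev_def sum_product by (simp add: distrib_left power_add mult_ac)
  also have "\<dots> = (\<Sum>i<n. \<Sum>k<n. \<Sum>j<n. v i * c k * \<alpha> ^ (j * (i + (n - 1) * k)))"
    by (subst sum.swap, rule sum.cong[OF refl], subst sum.swap) simp
  also have "\<dots> = (\<Sum>i<n. \<Sum>k<n. if i = k then - (v i * c k) else 0)"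
    by (intro sum.cong refl) (auto simp: sum_alpha_powers dvd[unfolded One_nat_def] simp flip: sum_distrib_left)
  also have "\<dots> = - (\<Sum>i<n. v i * c i)" by (simp add: sum_negf)
  finally show ?thesis .
qed

text \<open>For odd m, negation modulo n carries the exponents below n outside this set onto
  \<open>T_set 0 3 m\<close>.\<close>

definition dual_zeros :: "nat set" where
  "dual_zeros = {j. j < n \<and> w3 j mod 4 < 2}"

text \<open>If v has these zeros, every product in \<open>parseval\<close> vanishes: the first
  factor at exponents in \<open>dual_zeros\<close>, the second elsewhere. Conversely, a nonzero
  value of v at such an exponent is detected by a trace word of the code.\<close>

lemma dual_code_eq:
  assumes "odd m"
  shows "dual_code n (cyclic_code \<alpha> 0 3 m) = {v \<in> words n. \<forall>j\<in>dual_zeros. ev \<alpha> n v j = 0}"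
proof (intro equalityI subsetI)
  have code: "cyclic_code \<alpha> 0 3 m = {c \<in> words n. \<forall>t\<in>T_set 0 3 m. ev \<alpha> n c t = 0}"
    unfolding cyclic_code_def n_def[symmetric] gen_poly_dvd_iff ..
  {
    fix v assume v: "v \<in> {v \<in> words n. \<forall>j\<in>dual_zeros. ev \<alpha> n v j = 0}"
    have "(\<Sum>i<n. v i * c i) = 0" if c: "c \<in> cyclic_code \<alpha> 0 3 m" for c
    proof -
      have "ev \<alpha> n v j * ev \<alpha> n c ((n - 1) * j) = 0" if j: "j < n" for j
      proof (cases "j \<in> dual_zeros")
        case False
        then have w: "\<not> w3 j mod 4 < 2" using j by (simp add: dual_zeros_def)
        then have j0: "0 < j" by (intro gr0I) simp
        have "w3 (n - j) mod 4 = 0 \<or> w3 (n - j) mod 4 = 3" using w mod_4_complement[OF w3_neg assms] j by simp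
        then have "n - j \<in> T_set 0 3 m" using j j0 by (auto simp: T_set_def n_def)
        moreover have "(n - 1) * j mod n = (n - j) mod n"
        proof -
          have "(n - 1) * j + n = n * j + (n - j)" using pred_n_mult[of j] j by linarith
          then show ?thesis by (metis mod_add_self2 mod_mult_self4)
        qed
        then have "ev \<alpha> n c ((n - 1) * j) = ev \<alpha> n c (n - j)" by (rule ev_cong)
        ultimately show ?thesis using c by (simp add: code)
      qed (use v in simp)
      then have "(\<Sum>j<n. ev \<alpha> n v j * ev \<alpha> n c ((n - 1) * j)) = 0" by (intro sum.neutral) simp
      then show ?thesis by (simp only: parseval neg_equal_0_iff_equal)
    qed
    then show "v \<in> dual_code n (cyclic_code \<alpha> 0 3 m)" using v by (simp add: dual_code_def)
  next
    fix v assume v: "v \<in> dual_code n (cyclic_code \<alpha> 0 3 m)"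
    then have vw: "v \<in> words n" by (simp add: dual_code_def)
    have "ev \<alpha> n v j = 0" if "j \<in> dual_zeros" for j
    proof (rule ccontr)
      assume E: "ev \<alpha> n v j \<noteq> 0"
      have j: "j < n" "w3 j mod 4 < 2" using that by (auto simp: dual_zeros_def)
      obtain x :: 'a where x: "(\<Sum>s<m. x ^ 3 ^ s) \<noteq> 0" using trace_nonzero by blast
      \<comment> \<open>The inner product of v with the trace word is the trace of \<theta> times
        the value at j; this choice turns it into the nonzero trace of x.\<close>
      define \<theta> where "\<theta> = x / ev \<alpha> n v j"
      define c where "c i = (if i < n then \<Sum>s<m. (\<theta> * \<alpha> ^ (i * j)) ^ 3 ^ s else 0)" for i
      have tr: "(\<Sum>s<m. y ^ 3 ^ s) ^ 3 = (\<Sum>s<m. y ^ 3 ^ s)" for y :: 'a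
      proof -
        have "(\<Sum>s<m. y ^ 3 ^ s) ^ 3 = (\<Sum>s<m. y ^ 3 ^ Suc s)"
          by (simp add: cube_sum mult.commute flip: power_mult)
        also have "\<dots> = (\<Sum>s<m. y ^ 3 ^ s) + y ^ 3 ^ m - y ^ 3 ^ 0"
          using sum.lessThan_Suc[of "\<lambda>s. y ^ 3 ^ s" m] sum.lessThan_Suc_shift[of "\<lambda>s. y ^ 3 ^ s" m] by simp
        finally show ?thesis by (simp add: power_card)
      qed
      have "c \<in> words n" by (simp add: words_iff c_def tr)
      moreover have "ev \<alpha> n c t = 0" if t: "t \<in> T_set 0 3 m" for t
      proof -
        have "ev \<alpha> n c t = (\<Sum>i<n. \<Sum>s<m. \<theta> ^ 3 ^ s * \<alpha> ^ (i * (j * 3 ^ s + t)))"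
          unfolding ev_def c_def
          by (simp add: sum_distrib_left power_mult_distrib distrib_left power_add mult_ac flip: power_mult)
        also have "\<dots> = (\<Sum>s<m. \<theta> ^ 3 ^ s * (\<Sum>i<n. \<alpha> ^ (i * (j * 3 ^ s + t))))"
          by (subst sum.swap) (simp only: sum_distrib_left)
        also have "\<dots> = 0"
        proof (intro sum.neutral ballI)
          fix s
          have t': "0 < t" "t < n" "w3 t mod 4 = 0 \<or> w3 t mod 4 = 3"
            using t n_ge_2 by (auto simp: T_set_def n_def)
          \<comment> \<open>Otherwise t would be the negative of a rotation of j, against the digit
            sums modulo 4.\<close>
          have "\<not> n dvd j * 3 ^ s + t"
          proof
            assume "n dvd j * 3 ^ s + t"
            then have "n dvd j * 3 ^ s mod n + t" by (simp add: dvd_eq_mod_eq_0 mod_add_left_eq)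
            then obtain k where k: "j * 3 ^ s mod n + t = n * k" by (elim dvdE)
            moreover have "j * 3 ^ s mod n < n" using j by simp
            ultimately have "0 < n * k" "n * k < n * 2" using t' by linarith+
            then have "k = 1" by simp
            then have "j * 3 ^ s mod n = n - t" using k by simp
            then have "w3 j = w3 (n - t)" using w3_rotate_power[of j s] j by simp
            moreover have "w3 t + w3 (n - t) = 2 * m" using w3_neg[of t] t' by simp
            ultimately show False using mod_4_complement[OF _ assms, of "w3 t"] t' j by simp
          qed
          then show "\<theta> ^ 3 ^ s * (\<Sum>i<n. \<alpha> ^ (i * (j * 3 ^ s + t))) = 0"
            by (simp add: sum_alpha_powers)
        qed
        finally show ?thesis .
      qed
      ultimately have "c \<in> cyclic_code \<alpha> 0 3 m" by (simp add: code)
      then have orth: "(\<Sum>i<n. v i * c i) = 0" using v by (simp add: dual_code_def)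
      have "(\<Sum>i<n. v i * c i) = (\<Sum>i<n. \<Sum>s<m. (\<theta> * (v i * \<alpha> ^ (i * j))) ^ 3 ^ s)"
      proof (intro sum.cong refl)
        fix i assume "i \<in> {..<n}"
        moreover have "v i ^ 3 ^ s = v i" for s using vw by (simp add: words_iff prime_field_power)
        ultimately show "v i * c i = (\<Sum>s<m. (\<theta> * (v i * \<alpha> ^ (i * j))) ^ 3 ^ s)"
          by (simp add: c_def sum_distrib_left power_mult_distrib mult.left_commute)
      qed
      also have "\<dots> = (\<Sum>s<m. (\<theta> * ev \<alpha> n v j) ^ 3 ^ s)"
        by (subst sum.swap) (simp add: ev_def power_3_sum sum_distrib_left)
      finally show False using E x orth by (simp add: \<theta>_def)
    qed
    then show "v \<in> {v \<in> words n. \<forall>j\<in>dual_zeros. ev \<alpha> n v j = 0}" using vw by simp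
  }
qed

lemma card_dual_zeros:
  assumes "odd m"
  shows "2 * card dual_zeros + 1 = 3 ^ m + (if m mod 4 = 1 then 2 else 0)"
proof -
  \<comment> \<open>The count below 3^m also ranges over n itself, whose digit sum 2m is 2 modulo 4
    and so adds nothing.\<close>
  have "w3 n = 2 * m" using w3_neg[of n] w3_neg[of 0] by simp
  moreover have "\<not> 2 * m mod 4 < 2" using assms by presburger
  ultimately have wn: "\<not> w3 n mod 4 < 2" by simp
  have "{j. j < 3 ^ m \<and> (w3 j + 0) mod 4 < 2} = dual_zeros"
  proof (intro set_eqI)
    fix j
    have "j < 3 ^ m \<longleftrightarrow> j < n \<or> j = n" using n_ge_2 unfolding n_def by linarith
    then show "j \<in> {j. j < 3 ^ m \<and> (w3 j + 0) mod 4 < 2} \<longleftrightarrow> j \<in> dual_zeros"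
      unfolding dual_zeros_def mem_Collect_eq add_0_right using wn by blast
  qed
  then have "card dual_zeros = w3_count m 0" by (simp add: w3_count_def)
  moreover have "m mod 4 < 2 \<longleftrightarrow> m mod 4 = 1" using assms by presburger
  ultimately show ?thesis using w3_count_eq[of m 0] by simp
qed

lemma card_dual_code:
  assumes "odd m"
  shows "card (dual_code n (cyclic_code \<alpha> 0 3 m)) = 3 ^ (n - card dual_zeros)"
  unfolding dual_code_eq[OF assms]
proof (rule card_words_with_zeros)
  show "dual_zeros \<subseteq> {..<n}" by (auto simp: dual_zeros_def)
  show "3 * j mod n \<in> dual_zeros" if "j \<in> dual_zeros" for j
    using that w3_rotate[of j m, folded n_def] n_ge_2 by (simp add: dual_zeros_def)
qed

end

section \<open>Minimum distance\<close>

text \<open>Again a goes to 2 - a. This form serves when the zeros are read as values at powers of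
  \<open>inverse \<alpha>\<close>.\<close>

lemma mod_4_complement':
  fixes a b m :: nat
  assumes "a + b = 2 * m" "odd m"
  shows "a mod 4 < 2 \<longleftrightarrow> b mod 4 = 1 \<or> b mod 4 = 2"
  using assms by presburger

context ternary_field
begin

lemma alpha_half:
  assumes "n = 2 * N"
  shows "\<alpha> ^ N = -1"
proof -
  have "0 < N" "N < n" using n_ge_2 assms by auto
  then have "\<alpha> ^ N \<noteq> 1" using alpha_power_eq_1_iff[of N] by (auto dest: dvd_imp_le)
  moreover have "(\<alpha> ^ N)\<^sup>2 = 1" using alpha_order(1) assms by (simp add: mult.commute flip: power_mult)
  ultimately show ?thesis by (simp add: power2_eq_1_iff)
qed

lemma ev_inverse:
  assumes "j \<le> n"
  shows "ev (inverse \<alpha>) n v j = ev \<alpha> n v (n - j)"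
  unfolding ev_def
proof (intro sum.cong refl arg_cong2[where f = "(*)"])
  fix i
  have "\<alpha> ^ (i * (n - j)) * \<alpha> ^ (i * j) = \<alpha> ^ (i * n)"
    using assms by (simp flip: power_add distrib_left)
  also have "\<dots> = 1" by (simp add: alpha_power_eq_1_iff)
  finally show "inverse \<alpha> ^ (i * j) = \<alpha> ^ (i * (n - j))"
    by (simp add: power_inverse inverse_unique mult.commute)
qed

text \<open>For even h the digit sum 2h is 0 modulo 4, so the multiples of q - 1 are zeros
  themselves. Adding q^2 puts a digit 1 in front, which gives the odd progression with digit sums 1
  modulo 4.\<close>

lemma hweight_ge_1_mod_4:
  assumes m: "m = 2 * h + 1" "even h" "2 \<le> h"
    and zeros: "\<And>j. j \<in> dual_zeros \<Longrightarrow> ev \<alpha> n v j = 0" and nz: "i0 < n" "v i0 \<noteq> 0"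
  shows "3 ^ h + 15 \<le> 2 * hweight n v"
proof -
  define q where "q = (3::nat) ^ h"
  have q: "9 \<le> q" using power_increasing[OF m(3), of "3::nat"] by (simp add: q_def)
  have sq: "3 ^ (2 * h) = q * q" by (simp add: q_def mult_2 power_add)
  have n: "n + 1 = 3 * (q * q)" using n_ge_2 sq by (simp add: n_def m(1))
  have "even n" "odd q" by (simp_all add: n_def q_def)
  then obtain N where N: "n = 2 * N" by (elim evenE)
  have ev0: "ev \<alpha> (2 * N) v j = 0" if "w3 j mod 4 < 2" "j < n" for j
    using zeros[of j] that unfolding N[symmetric] dual_zeros_def by blast
  have h4: "2 * h mod 4 = 0" using m(2) by presburger
  have w: "w3 (i * (q - 1)) = 2 * h" if "1 \<le> i" "i \<le> q" for i
    using w3_mult_pred_power[of i h] that by (simp add: q_def)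
  have le: "i * (q - 1) < q * q" if "i \<le> q + 1" for i
  proof -
    have "i * (q - 1) \<le> (q + 1) * (q - 1)" using that by (rule mult_le_mono1)
    also have "\<dots> < q * q" using q by (cases q) auto
    finally show ?thesis .
  qed
  have "q + 2 < hweight (2 * N) v \<or> 2 * ((q + 1) + 1) \<le> hweight (2 * N) v"
  proof (rule hweight_folding_bound[where \<beta> = \<alpha> and u = "q - 1" and a = "q * q"])
    show "\<alpha> ^ N = - 1" by (rule alpha_half[OF N])
    show "inj_on (\<lambda>i. \<alpha> ^ i) {..<2 * N}" using alpha_order(2) N by simp
    show "(2::'a) \<noteq> 0" by (simp add: two_eq)
    show "even (q - 1)" "odd (q * q)" using \<open>odd q\<close> by simp_all
    show "3 * (q - 1) * (q - 1 + 2) + 2 = 2 * N" using n q N by (cases q) auto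
    show "ev \<alpha> (2 * N) v (i * (q - 1)) = 0" if "i < q + 2" for i
    proof -
      have "w3 (i * (q - 1)) mod 4 < 2"
      proof (cases "1 \<le> i \<and> i \<le> q")
        case False
        \<comment> \<open>The progression extends by one term at each end: 0, and q^2 - 1 with digit
          sum 4h.\<close>
        then have "i = 0 \<or> i = q + 1" using that by auto
        moreover have "(q + 1) * (q - 1) = 3 ^ (2 * h) - 1" unfolding sq by (cases q) auto
        then have "w3 ((q + 1) * (q - 1)) = 2 * (2 * h)" using w3_complement[of 0 "2 * h"] by simp
        ultimately show ?thesis using h4 by (elim disjE) simp_all
      qed (use w h4 in simp)
      moreover have "i * (q - 1) < n" using le[of i] that n q by simp
      ultimately show ?thesis by (rule ev0)
    qed
    show "ev \<alpha> (2 * N) v (q * q + i * (q - 1)) = 0" if "i < q + 1" for i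
    proof -
      have "w3 (q * q + i * (q - 1)) = 1 + w3 (i * (q - 1))"
        using w3_append[of "i * (q - 1)" "2 * h" 1] le[of i] that w3_power[of 0] by (simp add: sq)
      then have "w3 (q * q + i * (q - 1)) mod 4 < 2"
        using w[of i] h4 that by (cases "i = 0") (auto simp: mod_Suc)
      moreover have "q * q + i * (q - 1) < n" using le[of i] that n q by simp
      ultimately show ?thesis by (rule ev0)
    qed
  qed (use nz N in auto)
  \<comment> \<open>A weight of at least q + 3 suffices because q is at least 9.\<close>
  then show ?thesis using q N unfolding q_def[symmetric] by auto
qed

text \<open>For odd h the digit sum 2h is 2 modulo 4, so the negatives of the multiples of q - 1 are
  zeros, and \<open>inverse \<alpha>\<close> replaces \<alpha>. Lowering one digit gives the odd
  progression with digit sum 2h - 1.\<close>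

lemma hweight_ge_3_mod_4:
  assumes m: "m = 2 * h + 1" "odd h" "3 \<le> h"
    and zeros: "\<And>j. j \<in> dual_zeros \<Longrightarrow> ev \<alpha> n v j = 0" and nz: "i0 < n" "v i0 \<noteq> 0"
  shows "3 ^ h + 13 \<le> 2 * hweight n v"
proof -
  define r where "r = (3::nat) ^ (h - 1)"
  define q where "q = 3 * r"
  have qh: "q = 3 ^ h" using m(3) by (cases h) (auto simp: q_def r_def)
  have r: "9 \<le> r" using power_increasing[of 2 "h - 1" "3::nat"] m(3) by (simp add: r_def)
  have q0: "0 < q" by (simp add: qh)
  have sq: "3 ^ (2 * h) = q * q" by (simp add: qh mult_2 power_add)
  have n: "n + 1 = 3 * (q * q)" using n_ge_2 sq by (simp add: n_def m(1))
  have "even n" "odd r" "odd q" by (simp_all add: n_def r_def qh)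
  then obtain N where N: "n = 2 * N" by (elim evenE)
  have "odd m" by (simp add: m(1))
  \<comment> \<open>The exponent 0 is its own negative modulo n and is treated apart, since n - 0 is
    not below n.\<close>
  have neg: "ev (inverse \<alpha>) (2 * N) v j = 0" if "j = 0 \<or> w3 j mod 4 = 1 \<or> w3 j mod 4 = 2" "j < n" for j
  proof (cases "j = 0")
    case True
    have "0 \<in> dual_zeros" using n_ge_2 by (simp add: dual_zeros_def)
    from zeros[OF this] show ?thesis using True N by (simp add: ev_def)
  next
    case False
    have "w3 (n - j) + w3 j = 2 * m" using w3_neg that by simp
    then have "w3 (n - j) mod 4 < 2" using mod_4_complement'[OF _ \<open>odd m\<close>] that False by blast
    then have "n - j \<in> dual_zeros" using False that by (simp add: dual_zeros_def)
    from zeros[OF this] show ?thesis using ev_inverse[of j v] that N by simp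
  qed
  obtain k where "h = 2 * k + 1" using m(2) by (elim oddE)
  then have "2 * h = 4 * k + 2" "2 * h - 1 = 4 * k + 1" by simp_all
  then have h4: "2 * h mod 4 = 2" "(2 * h - 1) mod 4 = 1" by (simp_all only: mod_mult_self4) simp_all
  have "q + 1 < hweight (2 * N) v \<or> 2 * (2 * r + 1) \<le> hweight (2 * N) v"
  proof (rule hweight_folding_bound[where \<beta> = "inverse \<alpha>" and u = "q - 1" and a = "q - 1 - r"])
    show "inverse \<alpha> ^ N = - 1" using alpha_half[OF N] by (simp add: power_inverse)
    show "inj_on (\<lambda>i. inverse \<alpha> ^ i) {..<2 * N}" using alpha_order(2) N
      by (simp add: power_inverse inj_on_def)
    show "(2::'a) \<noteq> 0" by (simp add: two_eq)
    show "even (q - 1)" using \<open>odd q\<close> by simp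
    show "odd (q - 1 - r)" using \<open>odd q\<close> \<open>odd r\<close> r by (simp add: q_def)
    show "3 * (q - 1) * (q - 1 + 2) + 2 = 2 * N" using n q0 N by (cases q) auto
    have le: "i * (q - 1) < n" if "i \<le> q" for i
    proof -
      have "i * (q - 1) \<le> q * q" using that by (intro mult_le_mono) auto
      moreover have "0 < q * q" using r by (simp add: q_def)
      ultimately show ?thesis using n by linarith
    qed
    show "ev (inverse \<alpha>) (2 * N) v (i * (q - 1)) = 0" if "i < q + 1" for i
      using that neg[of "i * (q - 1)"] le[of i] w3_mult_pred_power[of i h] h4
      by (cases "i = 0") (auto simp: qh)
    show "ev (inverse \<alpha>) (2 * N) v (q - 1 - r + i * (q - 1)) = 0" if i: "i < 2 * r" for i
    proof (rule neg)
      \<comment> \<open>The exponent is (i + 1)(q - 1) - r, and t is the leading one of the h digits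
        of i. As t is at most 1, subtracting r lowers the leading digit 2 - t of the lower block to
        1 - t without borrowing.\<close>
      define t where "t = i div r"
      have t: "t \<le> 1" using i r by (simp add: t_def div_less_iff_less_mult less_Suc_eq_le[symmetric] mult.commute)
      have it: "i = t * r + i mod r" "i mod r < r" using r by (simp_all add: t_def)
      have s1: "q - 1 - r + i * (q - 1) = i * q + ((1 - t) * r + (r - 1 - i mod r))"
      proof -
        have "i * (q - 1) + i = i * q" using q0 by (cases q) auto
        moreover have "(1 - t) * r + t * r = r" using t by (cases "t = 0") auto
        moreover have "q = 3 * r" by (simp add: q_def)
        ultimately show ?thesis using it r i by linarith
      qed
      have "r - 1 - i mod r < 3 ^ (h - 1)" using r by (simp add: r_def)
      then have low: "w3 ((1 - t) * r + (r - 1 - i mod r)) = w3 (1 - t) + w3 (r - 1 - i mod r)"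
        unfolding r_def by (rule w3_append)
      have "(1 - t) * r \<le> 1 * r" by (rule mult_le_mono1) simp
      then have "(1 - t) * r + (r - 1 - i mod r) < 3 ^ h" unfolding qh[symmetric] q_def using r by linarith
      then have "w3 (q - 1 - r + i * (q - 1)) = w3 i + (w3 (1 - t) + w3 (r - 1 - i mod r))"
        using w3_append[of _ h i, folded qh] unfolding s1 low[symmetric] qh[symmetric] by blast
      moreover have "w3 i = w3 t + w3 (i mod r)"
        using w3_append[of "i mod r" "h - 1" t, folded r_def] it by metis
      moreover have "w3 (r - 1 - i mod r) + w3 (i mod r) = 2 * (h - 1)"
        using w3_complement[of "i mod r" "h - 1", folded r_def] it by blast
      moreover have "w3 t + w3 (1 - t) = 1"
        using t w3_power[of 0] by (auto simp: le_Suc_eq)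
      ultimately have "w3 (q - 1 - r + i * (q - 1)) = 2 * h - 1" using m(3) by linarith
      then show "q - 1 - r + i * (q - 1) = 0 \<or> w3 (q - 1 - r + i * (q - 1)) mod 4 = 1 \<or>
          w3 (q - 1 - r + i * (q - 1)) mod 4 = 2"
        using h4 by simp
      have "q - 1 - r + i * (q - 1) \<le> (i + 1) * (q - 1)" by simp
      also have "\<dots> < n" using i by (intro le) (simp add: q_def)
      finally show "q - 1 - r + i * (q - 1) < n" .
    qed
  qed (use nz N in auto)
  then show ?thesis using r N unfolding qh[symmetric] q_def by auto
qed

section \<open>The case of 26 positions\<close>

lemma ev_cube:
  assumes "v \<in> words n"
  shows "ev \<alpha> n v (3 * j) = ev \<alpha> n v j ^ 3"
  unfolding ev_def cube_sum
  by (intro sum.cong refl) (use assms in \<open>simp add: words_iff power_mult_distrib mult_ac flip: power_mult\<close>)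

lemma hweight_ge_m_eq_3:
  assumes m: "m = 3" and v: "v \<in> words n"
    and zeros: "\<And>j. j \<in> dual_zeros \<Longrightarrow> ev \<alpha> n v j = 0" and nz: "i0 < n" "v i0 \<noteq> 0"
  shows "8 \<le> hweight n v"
proof (rule ccontr)
  assume "\<not> ?thesis"
  then have wt: "hweight n v \<le> 7" by simp
  have n: "n = 26" by (simp add: n_def m)
  define A where "A = ev \<alpha> n v"
  have per: "A (j + 26) = A j" for j unfolding A_def by (rule ev_cong) (simp add: n)
  have cube: "A (3 * j) = A j ^ 3" for j unfolding A_def by (rule ev_cube[OF v])
  have A0: "A j = 0" if "w3 j mod 4 < 2" "j < 26" for j
  proof -
    have "j < n" using that n by simp
    then show ?thesis using zeros[of j] that unfolding dual_zeros_def A_def by blast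
  qed
  have z: "A 0 = 0" "A 1 = 0" "A 8 = 0" "A 14 = 0" "A 17 = 0"
    by (rule A0; simp add: w3.simps)+
  show False
  proof (cases "A 2 = 0")
    case True
    \<comment> \<open>Modulo 26 these are the exponents 22 to 25 and 0 to 3, eight in a row.\<close>
    have A22: "A (22 + i) = 0" if "i < 8" for i
    proof -
      have "A 3 = 0" "A 24 = 0" "A 22 = 0" "A 25 = 0" "A 23 = 0"
        using cube[of 1] cube[of 8] cube[of 16] cube[of 17] cube[of 25] cube[of 14]
          per[of 16] per[of 22] per[of 25] per[of 23] per[of 49] z by simp_all
      moreover have "i = 0 \<or> i = 1 \<or> i = 2 \<or> i = 3 \<or> i = 4 \<or> i = 5 \<or> i = 6 \<or> i = 7" using that by auto
      ultimately show ?thesis using z True per[of 0] per[of 1] per[of 2] per[of 3] by (elim disjE) simp_all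
    qed
    have "8 < card {k \<in> {..<n}. v k * \<alpha> ^ (k * 22) \<noteq> 0}"
    proof (rule card_support_gt[where y = "\<lambda>k. v k * \<alpha> ^ (k * 22)"])
      show "(\<Sum>k<n. v k * \<alpha> ^ (k * 22) * (\<alpha> ^ k) ^ i) = 0" if "i < 8" for i
        using A22[OF that] by (simp add: A_def ev_def distrib_left power_add mult.assoc flip: power_mult)
    qed (use alpha_order(2) nz in auto)
    then show False using wt by (simp add: hweight_def)
  next
    case False
    obtain p where p: "A 2 = \<alpha> ^ p" using primitive False by (auto simp: primitive_elem_def)
    have half: "\<alpha> ^ 13 = -1" by (rule alpha_half) (simp add: n)
    \<comment> \<open>As - 1 is the odd power \<open>\<alpha> ^ 13\<close>, one of
      \<open>A 2\<close> and its negative is a square.\<close>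
    obtain e r where e: "e ^ 3 = e" "e * A 2 = (\<alpha> ^ r)\<^sup>2"
    proof (cases "even p")
      case True
      then obtain r where "p = 2 * r" by (elim evenE)
      then show ?thesis using that[of 1 r] p by (simp add: mult.commute flip: power_mult)
    next
      case False
      then have "even (p + 13)" by simp
      then obtain r where "p + 13 = r * 2" by (metis evenE mult.commute)
      then have "\<alpha> ^ (p + 13) = (\<alpha> ^ r)\<^sup>2" by (simp only: power_mult)
      then show ?thesis using that[of "-1" r] p by (simp add: power_add half)
    qed
    define S where "S = {i. i < n \<and> v i \<noteq> 0}"
    \<comment> \<open>The support is padded to exactly seven positions so that the locator has
      degree exactly 7.\<close>
    obtain K where K: "S \<subseteq> K" "K \<subseteq> {..<n}" "card K = 7"
      using exists_subset_between[of S 7 "{..<n}"] wt by (auto simp: S_def hweight_def n)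
    have fin: "finite K" using K(2) finite_subset by blast
    have AK: "(\<Sum>k\<in>K. v k * (\<alpha> ^ k) ^ j) = A j" for j
      unfolding A_def ev_def power_mult
      by (rule sum.mono_neutral_left) (use K in \<open>auto simp: S_def\<close>)
    obtain s where s: "s 7 = 1" "\<And>j. (\<Sum>t\<le>7. s t * A (j + t)) = 0"
      using power_sums_recurrence[OF fin, of v "\<lambda>k. \<alpha> ^ k"] unfolding AK K(3) by blast
    have F27: "x ^ 27 = x" for x :: 'a using power_card[of x] m by simp
    show False
      by (rule no_locator_of_degree_7[OF three_eq_0 F27 per cube z s e]) simp
  qed
qed

end

section \<open>Dimension and minimum distance of the dual code\<close>

lemma ternary_code_dim: "card C = 3 ^ k \<Longrightarrow> code_dim C = k"
  unfolding code_dim_def by (rule the_equality) auto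

text \<open>Weights are at most n and a nonzero word exists, so \<open>Min\<close> is taken over a
  finite nonempty set.\<close>

lemma min_dist_ge:
  assumes "\<exists>c\<in>C. c \<noteq> (\<lambda>_. 0)" "\<And>c. c \<in> C \<Longrightarrow> c \<noteq> (\<lambda>_. 0) \<Longrightarrow> d \<le> hweight n c"
  shows "d \<le> min_dist n C"
proof -
  let ?W = "{hweight n c | c. c \<in> C \<and> c \<noteq> (\<lambda>_. 0)}"
  have "hweight n c \<le> n" for c :: "nat \<Rightarrow> 'a"
    unfolding hweight_def using card_mono[of "{..<n}" "{i. i < n \<and> c i \<noteq> 0}"] by auto
  then have "?W \<subseteq> {..n}" by auto
  then have "finite ?W" using finite_subset by blast
  moreover have "?W \<noteq> {}" using assms(1) by blast
  ultimately have "Min ?W \<in> ?W" by (rule Min_in)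
  then show ?thesis unfolding min_dist_def using assms(2) by auto
qed

theorem theorem7:
  fixes \<alpha> :: "'a::{field,finite}" and m :: nat
  assumes "m \<ge> 3" and "odd m"
    and "card (UNIV :: 'a set) = 3 ^ m"
    and "primitive_elem \<alpha>"
  defines "n \<equiv> 3 ^ m - 1"
  defines "D \<equiv> dual_code n (cyclic_code \<alpha> 0 3 m)"
  shows "(m mod 4 = 1 \<longrightarrow>
            real (min_dist n D) \<ge> (3 ^ ((m - 1) div 2) + 15) / 2 \<and>
            code_dim D = (n - 2) div 2)
       \<and> (m mod 4 = 3 \<longrightarrow>
            real (min_dist n D) \<ge> (3 ^ ((m - 1) div 2) + 13) / 2 \<and>
            code_dim D = n div 2)"
proof -
  interpret ternary_field \<alpha> m n
    using assms by unfold_locales auto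
  define h where "h = (m - 1) div 2"
  have h: "m = 2 * h + 1" using \<open>odd m\<close> by (auto simp: h_def elim: oddE)
  have D: "D = {v \<in> words n. \<forall>j\<in>dual_zeros. ev \<alpha> n v j = 0}"
    unfolding D_def by (rule dual_code_eq[OF \<open>odd m\<close>])
  have cardD: "card D = 3 ^ (n - card dual_zeros)"
    unfolding D_def by (rule card_dual_code[OF \<open>odd m\<close>])
  have n1: "n + 1 = 3 ^ m" using n_ge_2 by (simp add: n_def)
  have n26: "26 \<le> n" using power_increasing[OF \<open>m \<ge> 3\<close>, of "3::nat"] n1 by simp
  have Z: "2 * card dual_zeros = n + (if m mod 4 = 1 then 2 else 0)"
    using card_dual_zeros[OF \<open>odd m\<close>] n1 by simp
  have dim: "code_dim D = (if m mod 4 = 1 then (n - 2) div 2 else n div 2)"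
    using ternary_code_dim[OF cardD] Z by auto
  have "card D \<noteq> 1" using cardD Z n26 by (auto split: if_splits)
  have nontriv: "\<exists>c\<in>D. c \<noteq> (\<lambda>_. 0)"
  proof (rule ccontr)
    assume "\<not> ?thesis"
    then have "D \<subseteq> {\<lambda>_. 0}" by blast
    moreover have "D \<noteq> {}" using cardD by (metis card.empty power_not_zero zero_neq_numeral)
    ultimately have "D = {\<lambda>_. 0}" by blast
    then show False using \<open>card D \<noteq> 1\<close> by simp
  qed
  have nz: "\<exists>i<n. c i \<noteq> 0" if c: "c \<in> D" "c \<noteq> (\<lambda>_. 0)" for c
  proof -
    obtain i where "c i \<noteq> 0" using c(2) by auto
    moreover have "c \<in> words n" using c(1) unfolding D by blast
    ultimately show ?thesis unfolding words_iff by (meson linorder_not_less)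
  qed
  have bound: "(3 ^ h + d) / 2 \<le> real (min_dist n D)"
    if "\<And>c. c \<in> D \<Longrightarrow> c \<noteq> (\<lambda>_. 0) \<Longrightarrow> 3 ^ h + d \<le> 2 * hweight n c" for d :: nat
  proof -
    \<comment> \<open>Weights are integers, so the bound is passed to the minimum as the ceiling of
      the half.\<close>
    have "(3 ^ h + d + 1) div 2 \<le> min_dist n D"
      by (rule min_dist_ge[OF nontriv]) (use that in fastforce)
    then have "3 ^ h + d \<le> 2 * min_dist n D" by linarith
    then have "real (3 ^ h + d) \<le> real (2 * min_dist n D)" by (simp only: of_nat_le_iff)
    then show ?thesis by simp
  qed
  have 1: "(3 ^ h + 15) / 2 \<le> real (min_dist n D)" if "m mod 4 = 1"
  proof -
    have "even h" "2 \<le> h" using that h \<open>m \<ge> 3\<close> by presburger+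
    then have "3 ^ h + 15 \<le> 2 * hweight n c" if "c \<in> D" "c \<noteq> (\<lambda>_. 0)" for c
      using nz[OF that] hweight_ge_1_mod_4[OF h] that by (auto simp: D)
    then show ?thesis using bound[of 15] by simp
  qed
  have 3: "(3 ^ h + 13) / 2 \<le> real (min_dist n D)" if "m mod 4 = 3"
  proof -
    have "odd h" using that h by presburger
    have "3 ^ h + 13 \<le> 2 * hweight n c" if c: "c \<in> D" "c \<noteq> (\<lambda>_. 0)" for c
    \<comment> \<open>Here m = 3, and the required value (3 + 13) / 2 is exactly 8.\<close>
    proof (cases "h = 1")
      case True
      then have "m = 3" using h by simp
      from hweight_ge_m_eq_3[OF this, of c] nz[OF c] c have "8 \<le> hweight n c" by (auto simp: D)
      then show ?thesis using True by simp
    next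
      case False
      then have "3 \<le> h" using \<open>odd h\<close> by presburger
      then show ?thesis
        using nz[OF c] hweight_ge_3_mod_4[OF h \<open>odd h\<close>] c by (auto simp: D)
    qed
    then show ?thesis using bound[of 13] by simp
  qed
  show ?thesis using 1 3 dim by (simp add: h_def)
qed

end
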